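(* Let $(W,S)$ be a Coxeter system, $w\in W$, let $\mathcal S=(J,H,M)$ be a system for $w$, and let $u\le w$ (or, more generally, let $u\in W_{\mathcal S}$ if $\mathcal S$ is of the first kind, and $u\in W'_{\mathcal S}$ if $\mathcal S$ is of the second kind). If $u=abc$ is any $\mathcal S$-factorization of $u$, then $$M_{\mathcal S}(u)=a\,M(b)\,c$$ (so $a\,M(b)\,c$ does not depend on the chosen $\mathcal S$-factorization), and $u\lhd M_{\mathcal S}(u)$ if and only if $b\lhd M(b)$. Consequently, $M_{\mathcal S}(u)=a\cdot M(b)\cdot c$ is an $\mathcal S$-factorization of $M_{\mathcal S}(u)$.
   Context: $(W,S)$ is a Coxeter system with identity $e$, length function $\ell$ and Bruhat order $\le$; $x\lhd y$ means $y$ covers $x$, and $[e,w]=\{u\in W: u\le w\}$. $D_R(u)=\{r\in S:\ell(ur)<\ell(u)\}$, $D_L(u)=\{r\in S:\ell(ru)<\ell(u)\}$. For $J\subseteq S$, $W_J$ is the subgroup generated by $J$, $W^J=\{u: D_R(u)\cap J=\emptyset\}$, ${}^JW=\{u:D_L(u)\cap J=\emptyset\}$; each $u\in W$ factors uniquely as $u=u^Ju_J$ with $u^J\in W^J$, $u_J\in W_J$, and uniquely as $u={}_Ju\,{}^Ju$ with ${}_Ju\in W_J$, ${}^Ju\in{}^JW$ (iterated notation such as $(u^J)^H$ applies these operations successively). $\mathrm{Supp}(u)=\{r\in S: r\le u\}$, $\mathrm{Supp}_H(u)=\mathrm{Supp}(u)\cap H$, $C_s=\{c\in S: sc=cs\}$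 (so $s\in C_s$). For $u\in W$ and $H\subseteq S$, $u_0(H)$ denotes the unique maximal element of $[e,u]\cap W_H$. A matching of a poset $P$ is an involution $M:P\to P$ such that for every $v$ either $v\lhd M(v)$ or $M(v)\lhd v$. For $r\in D_L(v)$ (resp. $r\in D_R(v)$), $\lambda_r$ (resp. $\rho_r$) is the matching $x\mapsto rx$ (resp. $x\mapsto xr$) of $[e,v]$; these are called multiplication matchings. For a matching $M$ of $[e,w_0(H)]$, "$M$ commutes with $\lambda_\alpha$" means that $\alpha\in D_L(w_0(H))$ and $M(\alpha x)=\alpha M(x)$ for all $x\in[e,w_0(H)]$; "$M$ commutes with $\rho_\beta$" means $\beta\in D_R(w_0(H))$ and $M(x\beta)=M(x)\beta$ for all $x\in[e,w_0(H)]$. If $s\in S$ and $C_s\subseteq J\subseteq S$, the $s$-complement of $J$ is the unique $K\subseteq S$ with $J\cup K=S$ and $J\cap K=C_s$. A system for $w$ is a triple $\mathcal S=(J,H,M)$ with $H\subseteq S$, $|H|\in\{1,2\}$, $M$ a matching of $[e,w_0(H)]$, and $C_{M(e)}\subseteq J\subseteq S$, such that, with $K$ the $M(e)$-complement of $J$: [S0] $M$ is a multiplication matching of $[e,w_0(H)]$ if and only if $|H|=1$; [S1] $w^J\in W_K$ (equivalently ${}^Kw\in W_J$); [S2] $|\mathrm{Supp}_H((w^J)^H)|\le1$ and if $\alpha\in\mathrm{Supp}_H((w^J)^H)$ then $M$ commutes with $\lambda_\alpha$; $|\mathrm{Supp}_H({}^H({}^Kw))|\le 1$ and if $\beta\in\mathrm{Supp}_H({}^H({}^Kw))$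 then $M$ commutes with $\rho_\beta$. An $\mathcal S$-factorization of $u\in W$ is a factorization $u=abc$ with $\ell(u)=\ell(a)+\ell(b)+\ell(c)$ such that: $a\in W_K\cap W^H$, $|\mathrm{Supp}_H(a)|\le1$, and if $\alpha\in\mathrm{Supp}_H(a)$ then $M$ commutes with $\lambda_\alpha$; $b\in W_H$; $c\in W_J\cap{}^HW$, $|\mathrm{Supp}_H(c)|\le1$, and if $\beta\in\mathrm{Supp}_H(c)$ then $M$ commutes with $\rho_\beta$. The system $\mathcal S$ is of the first kind if $H\subseteq K$, of the second kind if $H\subseteq J$ (every system is of at least one kind; it is of both kinds exactly when $|H|=1$). First kind: $a_{\mathcal S}(u)=(u^J)^H$, $b_{\mathcal S}(u)=(u^J)_H\,{}_H(u_J)$, $c_{\mathcal S}(u)={}^H(u_J)$ for $u\in W$; $W_{\mathcal S}=\{u\in W: u_0(H)\le w_0(H),\ a_{\mathcal S}(u)\le a_{\mathcal S}(w)\}$ (this contains $[e,w]$); and $M_{\mathcal S}(u)=a_{\mathcal S}(u)M(b_{\mathcal S}(u))c_{\mathcal S}(u)$ for $u\in W_{\mathcal S}$. Second kind: $a'_{\mathcal S}(u)=({}_Ku)^H$, $b'_{\mathcal S}(u)=({}_Ku)_H\,{}_H({}^Ku)$, $c'_{\mathcal S}(u)={}^H({}^Ku)$ for $u\in W$; $W'_{\mathcal S}=\{u\in W: u_0(H)\le w_0(H),\ c'_{\mathcal S}(u)\le c'_{\mathcal S}(w)\}$ (this contains $[e,w]$); and $M_{\mathcal S}(u)=a'_{\mathcal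 S}(u)M(b'_{\mathcal S}(u))c'_{\mathcal S}(u)$ for $u\in W'_{\mathcal S}$. If $\mathcal S$ is of both kinds, the claim holds for either of the two definitions of $M_{\mathcal S}$ (on the corresponding domain); in particular the two definitions agree on $[e,w]$. *)

theory Defs
  imports "HOL-Algebra.Generated_Groups"
begin

text \<open>A Coxeter matrix on \<open>S\<close>; the entry \<open>0\<close> encodes \<open>\<infinity>\<close> (no relation).\<close>

definition coxeter_matrix :: "'a set \<Rightarrow> ('a \<Rightarrow> 'a \<Rightarrow> nat) \<Rightarrow> bool" where
  "coxeter_matrix S m \<longleftrightarrow>
     (\<forall>s\<in>S. m s s = 1) \<and>
     (\<forall>s\<in>S. \<forall>t\<in>S. m s t = m t s) \<and>
     (\<forall>s\<in>S. \<forall>t\<in>S. s \<noteq> t \<longrightarrow> m s t \<noteq> 1)"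

text \<open>Deletion of a relator \<open>(s t)^m(s,t)\<close> from a word.  If \<open>m s t = 0\<close> the relator is empty.
  Since \<open>m s s = 1\<close>, the letters are involutions modulo the generated congruence, so that
  the monoid presented by these relations is the group
  \<open>\<langle>S | (s t)^m(s,t) = 1\<rangle>\<close>; no formal inverses are needed.\<close>

inductive coxeter_deletion :: "'a set \<Rightarrow> ('a \<Rightarrow> 'a \<Rightarrow> nat) \<Rightarrow> 'a list \<Rightarrow> 'a list \<Rightarrow> bool"
  for S :: "'a set" and m :: "'a \<Rightarrow> 'a \<Rightarrow> nat" where
  "\<lbrakk>xs \<in> lists S; ys \<in> lists S; s \<in> S; t \<in> S\<rbrakk>
     \<Longrightarrow> coxeter_deletion S m (xs @ concat (replicate (m s t) [s, t]) @ ys) (xs @ ys)"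

definition word_prod :: "('a, 'b) monoid_scheme \<Rightarrow> 'a list \<Rightarrow> 'a" where
  "word_prod G xs = foldr (\<otimes>\<^bsub>G\<^esub>) xs \<one>\<^bsub>G\<^esub>"

text \<open>\<open>S\<close> generates \<open>W\<close>, and two words in \<open>S\<close> have the same value in \<open>W\<close> exactly if the Coxeter
  relations identify them, i.e. \<open>W\<close> has the presentation above.\<close>

locale coxeter_system = group W for W (structure) +
  fixes S :: "'a set"
  assumes gens_closed: "S \<subseteq> carrier W"
    and gens_generate: "generate W S = carrier W"
    and presentation: "\<exists>m. coxeter_matrix S m \<and>
      (\<forall>xs\<in>lists S. \<forall>ys\<in>lists S.
         word_prod W xs = word_prod W ys \<longleftrightarrow> equivclp (coxeter_deletion S m) xs ys)"
begin

definition len :: "'a \<Rightarrow> nat" where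
  "len u = (LEAST n. \<exists>xs\<in>lists S. length xs = n \<and> word_prod W xs = u)"

definition reflections :: "'a set" where
  "reflections = {g \<otimes> s \<otimes> inv g | g s. g \<in> carrier W \<and> s \<in> S}"

definition bruhat_step :: "'a \<Rightarrow> 'a \<Rightarrow> bool" where
  "bruhat_step x y \<longleftrightarrow>
     x \<in> carrier W \<and> (\<exists>t\<in>reflections. y = x \<otimes> t) \<and> len x < len y"

definition bruhat_le :: "'a \<Rightarrow> 'a \<Rightarrow> bool"  (infix \<open>\<preceq>\<close> 50) where
  "x \<preceq> y \<longleftrightarrow> x \<in> carrier W \<and> bruhat_step\<^sup>*\<^sup>* x y"

definition covered_in :: "'a set \<Rightarrow> 'a \<Rightarrow> 'a \<Rightarrow> bool" where
  "covered_in P x y \<longleftrightarrow>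
     x \<in> P \<and> y \<in> P \<and> x \<preceq> y \<and> x \<noteq> y \<and>
     \<not> (\<exists>z\<in>P. x \<preceq> z \<and> x \<noteq> z \<and> z \<preceq> y \<and> z \<noteq> y)"

abbreviation covered :: "'a \<Rightarrow> 'a \<Rightarrow> bool"  (infix \<open>\<lhd>\<^sub>B\<close> 50) where
  "x \<lhd>\<^sub>B y \<equiv> covered_in (carrier W) x y"

definition lower :: "'a \<Rightarrow> 'a set" where
  "lower w = {u \<in> carrier W. u \<preceq> w}"

definition D_R :: "'a \<Rightarrow> 'a set" where
  "D_R u = {r \<in> S. len (u \<otimes> r) < len u}"

definition D_L :: "'a \<Rightarrow> 'a set" where
  "D_L u = {r \<in> S. len (r \<otimes> u) < len u}"

definition parabolic :: "'a set \<Rightarrow> 'a set" where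
  "parabolic J = generate W J"

text \<open>The sets \<open>W^J\<close> (\<open>quot_R J\<close>) and \<open>^J W\<close> (\<open>quot_L J\<close>).\<close>

definition quot_R :: "'a set \<Rightarrow> 'a set" where
  "quot_R J = {u \<in> carrier W. D_R u \<inter> J = {}}"

definition quot_L :: "'a set \<Rightarrow> 'a set" where
  "quot_L J = {u \<in> carrier W. D_L u \<inter> J = {}}"

text \<open>\<open>u = u^J u_J\<close> with \<open>u^J = min_R J u\<close> and \<open>u_J = par_R J u\<close>;
  \<open>u = _J u ^J u\<close> with \<open>_J u = par_L J u\<close> and \<open>^J u = min_L J u\<close>.\<close>

definition min_R :: "'a set \<Rightarrow> 'a \<Rightarrow> 'a" where
  "min_R J u = (THE x. x \<in> quot_R J \<and> (\<exists>y\<in>parabolic J. u = x \<otimes> y))"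

definition par_R :: "'a set \<Rightarrow> 'a \<Rightarrow> 'a" where
  "par_R J u = (THE y. y \<in> parabolic J \<and> (\<exists>x\<in>quot_R J. u = x \<otimes> y))"

definition min_L :: "'a set \<Rightarrow> 'a \<Rightarrow> 'a" where
  "min_L J u = (THE x. x \<in> quot_L J \<and> (\<exists>y\<in>parabolic J. u = y \<otimes> x))"

definition par_L :: "'a set \<Rightarrow> 'a \<Rightarrow> 'a" where
  "par_L J u = (THE y. y \<in> parabolic J \<and> (\<exists>x\<in>quot_L J. u = y \<otimes> x))"

definition Supp :: "'a \<Rightarrow> 'a set" where
  "Supp u = {r \<in> S. r \<preceq> u}"

definition commuting_gens :: "'a \<Rightarrow> 'a set" where
  "commuting_gens s = {c \<in> S. s \<otimes> c = c \<otimes> s}"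

text \<open>\<open>u_0(H)\<close>, the unique maximal element of \<open>[e,u] \<inter> W_H\<close>.\<close>

definition max_par :: "'a set \<Rightarrow> 'a \<Rightarrow> 'a" where
  "max_par H u = (THE x. x \<in> lower u \<inter> parabolic H \<and>
     (\<forall>y \<in> lower u \<inter> parabolic H. x \<preceq> y \<longrightarrow> y = x))"

text \<open>A matching is represented by a total function; only its values on \<open>P\<close> matter.\<close>

definition matching :: "'a set \<Rightarrow> ('a \<Rightarrow> 'a) \<Rightarrow> bool" where
  "matching P M \<longleftrightarrow>
     (\<forall>v\<in>P. M v \<in> P \<and> M (M v) = v \<and> (covered_in P v (M v) \<or> covered_in P (M v) v))"

definition mult_matching :: "'a \<Rightarrow> ('a \<Rightarrow> 'a) \<Rightarrow> bool" where
  "mult_matching v M \<longleftrightarrow>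
     (\<exists>r\<in>D_L v. \<forall>x\<in>lower v. M x = r \<otimes> x) \<or>
     (\<exists>r\<in>D_R v. \<forall>x\<in>lower v. M x = x \<otimes> r)"

definition commutes_left :: "'a \<Rightarrow> ('a \<Rightarrow> 'a) \<Rightarrow> 'a \<Rightarrow> bool" where
  "commutes_left v M \<alpha> \<longleftrightarrow> \<alpha> \<in> D_L v \<and> (\<forall>x\<in>lower v. M (\<alpha> \<otimes> x) = \<alpha> \<otimes> M x)"

definition commutes_right :: "'a \<Rightarrow> ('a \<Rightarrow> 'a) \<Rightarrow> 'a \<Rightarrow> bool" where
  "commutes_right v M \<beta> \<longleftrightarrow> \<beta> \<in> D_R v \<and> (\<forall>x\<in>lower v. M (x \<otimes> \<beta>) = M x \<otimes> \<beta>)"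

text \<open>The \<open>s\<close>-complement of \<open>J\<close>; meaningful if \<open>C_s \<subseteq> J \<subseteq> S\<close>.\<close>

definition complement :: "'a \<Rightarrow> 'a set \<Rightarrow> 'a set" where
  "complement s J = (THE K. K \<subseteq> S \<and> J \<union> K = S \<and> J \<inter> K = commuting_gens s)"

text \<open>The set \<open>K\<close> attached to a triple \<open>(J, H, M)\<close>; it does not depend on \<open>H\<close>.\<close>

abbreviation compl_of :: "'a set \<Rightarrow> ('a \<Rightarrow> 'a) \<Rightarrow> 'a set" where
  "compl_of J M \<equiv> complement (M \<one>) J"

definition left_admissible :: "'a \<Rightarrow> 'a set \<Rightarrow> ('a \<Rightarrow> 'a) \<Rightarrow> 'a \<Rightarrow> bool" where
  "left_admissible w H M a \<longleftrightarrow>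
     card (Supp a \<inter> H) \<le> 1 \<and> (\<forall>\<alpha>\<in>Supp a \<inter> H. commutes_left (max_par H w) M \<alpha>)"

definition right_admissible :: "'a \<Rightarrow> 'a set \<Rightarrow> ('a \<Rightarrow> 'a) \<Rightarrow> 'a \<Rightarrow> bool" where
  "right_admissible w H M c \<longleftrightarrow>
     card (Supp c \<inter> H) \<le> 1 \<and> (\<forall>\<beta>\<in>Supp c \<inter> H. commutes_right (max_par H w) M \<beta>)"

text \<open>\<open>(J, H, M)\<close> is a system for \<open>w\<close>; the last four conjuncts are S0, S1 and the two halves
  of S2.\<close>

definition system_for :: "'a \<Rightarrow> 'a set \<Rightarrow> 'a set \<Rightarrow> ('a \<Rightarrow> 'a) \<Rightarrow> bool" where
  "system_for w J H M \<longleftrightarrow>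
     H \<subseteq> S \<and> card H \<in> {1, 2} \<and>
     matching (lower (max_par H w)) M \<and>
     commuting_gens (M \<one>) \<subseteq> J \<and> J \<subseteq> S \<and>
     (mult_matching (max_par H w) M \<longleftrightarrow> card H = 1) \<and>
     min_R J w \<in> parabolic (compl_of J M) \<and>
     left_admissible w H M (min_R H (min_R J w)) \<and>
     right_admissible w H M (min_L H (min_L (compl_of J M) w))"

definition system_factorization ::
  "'a \<Rightarrow> 'a set \<Rightarrow> 'a set \<Rightarrow> ('a \<Rightarrow> 'a) \<Rightarrow> 'a \<Rightarrow> 'a \<Rightarrow> 'a \<Rightarrow> 'a \<Rightarrow> bool" where
  "system_factorization w J H M u a b c \<longleftrightarrow>
     u = a \<otimes> b \<otimes> c \<and> len u = len a + len b + len c \<and>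
     a \<in> parabolic (compl_of J M) \<inter> quot_R H \<and> left_admissible w H M a \<and>
     b \<in> parabolic H \<and>
     c \<in> parabolic J \<inter> quot_L H \<and> right_admissible w H M c"

definition first_kind :: "'a set \<Rightarrow> 'a set \<Rightarrow> ('a \<Rightarrow> 'a) \<Rightarrow> bool" where
  "first_kind J H M \<longleftrightarrow> H \<subseteq> compl_of J M"

definition second_kind :: "'a set \<Rightarrow> 'a set \<Rightarrow> bool" where
  "second_kind J H \<longleftrightarrow> H \<subseteq> J"

text \<open>The domain \<open>W\<^sub>\<S>\<close> and the map \<open>M\<^sub>\<S>\<close> for systems of the first kind.\<close>

definition dom1 :: "'a \<Rightarrow> 'a set \<Rightarrow> 'a set \<Rightarrow> 'a set" where
  "dom1 w J H = {u \<in> carrier W.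
     max_par H u \<preceq> max_par H w \<and> min_R H (min_R J u) \<preceq> min_R H (min_R J w)}"

definition sys_map1 :: "'a set \<Rightarrow> 'a set \<Rightarrow> ('a \<Rightarrow> 'a) \<Rightarrow> 'a \<Rightarrow> 'a" where
  "sys_map1 J H M u =
     min_R H (min_R J u) \<otimes>
     M (par_R H (min_R J u) \<otimes> par_L H (par_R J u)) \<otimes>
     min_L H (par_R J u)"

text \<open>The domain \<open>W'\<^sub>\<S>\<close> and the map \<open>M\<^sub>\<S>\<close> for systems of the second kind.\<close>

definition dom2 :: "'a \<Rightarrow> 'a set \<Rightarrow> 'a set \<Rightarrow> ('a \<Rightarrow> 'a) \<Rightarrow> 'a set" where
  "dom2 w J H M = {u \<in> carrier W.
     max_par H u \<preceq> max_par H w \<and>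
     min_L H (min_L (compl_of J M) u) \<preceq> min_L H (min_L (compl_of J M) w)}"

definition sys_map2 :: "'a set \<Rightarrow> 'a set \<Rightarrow> ('a \<Rightarrow> 'a) \<Rightarrow> 'a \<Rightarrow> 'a" where
  "sys_map2 J H M u =
     min_R H (par_L (compl_of J M) u) \<otimes>
     M (par_R H (par_L (compl_of J M) u) \<otimes> par_L H (min_L (compl_of J M) u)) \<otimes>
     min_L H (min_L (compl_of J M) u)"

end

end

theory Submission
  imports Defs "HOL-Library.Sublist"
begin

text \<open>
  Fix a system of the first kind, put \<open>s = M e\<close> and \<open>C = C\<^sub>s\<close>.  Axiom S0 forces \<open>H \<inter> C = {s}\<close>.  If in a
  factorization \<open>u = abc\<close> the element \<open>ab\<close> has no right descent in \<open>C - {s}\<close>, then writing \<open>b = b'q\<close> with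
  \<open>q \<in> {e, s}\<close> maximal gives \<open>u\<^sup>J = ab'\<close> and \<open>u\<^sub>J = qc\<close>, so that \<open>(a, b, c)\<close> is the canonical factorization.
  Otherwise let \<open>p \<in> C - {s}\<close> be such a descent.  The exchange condition gives \<open>abp = a'b\<close> with \<open>a' < a\<close>,
  and comparing the supports of \<open>a\<^sup>-\<^sup>1a'\<close> and \<open>bpb\<^sup>-\<^sup>1\<close> shows that either \<open>p\<close> commutes with \<open>W\<^sub>H\<close>, or
  \<open>M b = bs\<close>; in both cases \<open>a M(b) c = a' M(b) pc\<close>.  The \<open>W\<^sub>H\<close>-part of \<open>a'\<close> is trivial or a letter
  with whose left multiplication \<open>M\<close> commutes, and can be absorbed in the middle factor.  As \<open>pc\<close> is
  longer than \<open>c\<close>, this process ends at the canonical factorization.  Systems of the second kind are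
  systems of the first kind in the opposite group.
\<close>

text \<open>What keeps a factorization from being canonical is a right descent of \<open>ab\<close>
  in \<open>J\<close> other than \<open>s\<close>: the canonical right part \<open>u_J\<close>
  should have absorbed it. Since \<open>ab\<close> lies in \<open>W_K\<close>, such a descent lies
  in \<open>J \<inter> K = C\<close>, and being different from \<open>s\<close> it lies outside
  \<open>H\<close>; this is why the exchange condition changes \<open>a\<close> and leaves
  \<open>b\<close> alone. The obstacle is that nothing is known about \<open>M\<close> beyond the
  matching axioms and the commutation with a letter of \<open>a\<close>, while the shift must be
  compatible with \<open>M(b)\<close>. The bound on the support of \<open>a\<close> in
  \<open>H\<close> resolves this: when \<open>p\<close> does not commute with \<open>W_H\<close>,
  the only candidates for \<open>b'\<close> are \<open>e\<close> and a single letter of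
  \<open>a\<close>, and there \<open>M\<close> is determined, because it exchanges \<open>e\<close>
  and \<open>s\<close> and commutes with left multiplication by that letter. Lengths need separate
  care. Additivity in \<open>a M(b) c\<close> cannot be read off during a shift. Each shift
  therefore only records that the difference of the lengths of \<open>M(b)\<close> and
  \<open>b\<close> is unchanged; additivity is proved at the canonical factorization and carried
  back.\<close>

context coxeter_system
begin

section \<open>Words, length and parity\<close>

lemma gen_closed [simp, intro]: "s \<in> S \<Longrightarrow> s \<in> carrier W"
  using gens_closed by auto

lemma word_prod_Nil [simp]: "word_prod W [] = \<one>"
  by (simp add: word_prod_def)

lemma word_prod_Cons [simp]: "word_prod W (x # xs) = x \<otimes> word_prod W xs"
  by (simp add: word_prod_def)

lemma word_prod_closed [simp, intro]: "xs \<in> lists S \<Longrightarrow> word_prod W xs \<in> carrier W"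
  by (induction xs) auto

lemma word_prod_append [simp]:
  "\<lbrakk>xs \<in> lists S; ys \<in> lists S\<rbrakk> \<Longrightarrow> word_prod W (xs @ ys) = word_prod W xs \<otimes> word_prod W ys"
  by (induction xs) (auto simp: m_assoc)

lemma word_prod_eq_if_deletion:
  assumes "coxeter_matrix S m"
    and "\<forall>xs\<in>lists S. \<forall>ys\<in>lists S.
         word_prod W xs = word_prod W ys \<longleftrightarrow> equivclp (coxeter_deletion S m) xs ys"
    and "s \<in> S" "t \<in> S"
  shows "word_prod W (concat (replicate (m s t) [s, t])) = \<one>"
proof -
  let ?r = "concat (replicate (m s t) [s, t])"
  have "coxeter_deletion S m ([] @ ?r @ []) ([] @ [])"
    by (rule coxeter_deletion.intros) (use assms in auto)
  then have "equivclp (coxeter_deletion S m) ?r []"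
    by (auto simp: r_into_equivclp)
  moreover have "?r \<in> lists S"
    using assms by (auto simp: lists_eq_set)
  ultimately have "word_prod W ?r = word_prod W []"
    using assms(2) by blast
  then show ?thesis by simp
qed

lemma gen_square [simp]:
  assumes "s \<in> S"
  shows "s \<otimes> s = \<one>"
proof -
  obtain m where m: "coxeter_matrix S m" "\<forall>xs\<in>lists S. \<forall>ys\<in>lists S.
         word_prod W xs = word_prod W ys \<longleftrightarrow> equivclp (coxeter_deletion S m) xs ys"
    using presentation by blast
  have "m s s = 1"
    using m(1) assms by (auto simp: coxeter_matrix_def)
  then show ?thesis
    using word_prod_eq_if_deletion[OF m assms assms] assms by simp
qed

lemma gen_inv [simp]: "s \<in> S \<Longrightarrow> inv s = s"
  by (rule inv_equality) auto

lemma gen_cancel [simp]: "\<lbrakk>s \<in> S; x \<in> carrier W\<rbrakk> \<Longrightarrow> s \<otimes> (s \<otimes> x) = x"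
  by (simp flip: m_assoc)

lemma gen_cancel_right [simp]: "\<lbrakk>s \<in> S; x \<in> carrier W\<rbrakk> \<Longrightarrow> x \<otimes> s \<otimes> s = x"
  by (simp add: m_assoc)

lemma inv_word_prod: "xs \<in> lists S \<Longrightarrow> inv (word_prod W xs) = word_prod W (rev xs)"
  by (induction xs) (auto simp: inv_mult_group in_lists_conv_set)

lemma mem_generate_iff:
  assumes "J \<subseteq> S"
  shows "x \<in> generate W J \<longleftrightarrow> (\<exists>xs\<in>lists J. x = word_prod W xs)"
proof
  assume "x \<in> generate W J"
  then show "\<exists>xs\<in>lists J. x = word_prod W xs"
  proof induction
    case one
    have "[] \<in> lists J" "\<one> = word_prod W []" by auto
    then show ?case by blast
  next
    case (incl h)
    with assms have "[h] \<in> lists J" "h = word_prod W [h]" by auto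
    then show ?case by blast
  next
    case (inv h)
    with assms have "[h] \<in> lists J" "inv h = word_prod W [h]" by auto
    then show ?case by blast
  next
    case (eng h1 h2)
    then obtain xs ys where "xs \<in> lists J" "h1 = word_prod W xs" "ys \<in> lists J" "h2 = word_prod W ys"
      by auto
    with assms have "xs @ ys \<in> lists J" "h1 \<otimes> h2 = word_prod W (xs @ ys)"
      by (auto simp: subset_iff lists_eq_set)
    then show ?case by blast
  qed
next
  assume "\<exists>xs\<in>lists J. x = word_prod W xs"
  then obtain xs where "xs \<in> lists J" "x = word_prod W xs" by blast
  then show "x \<in> generate W J"
    by (induction xs arbitrary: x) (auto intro: generate.intros)
qed

lemma word_exists: "x \<in> carrier W \<Longrightarrow> \<exists>xs\<in>lists S. word_prod W xs = x"
  using mem_generate_iff[of S x] gens_generate by auto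

text \<open>Equality of values is generated by deletion of relators, so invariance under one
  deletion suffices. All that is recorded about a relator is that it is a power of a two-letter word
  with value \<open>\<one>\<close>; the Coxeter matrix stays hidden from here on.\<close>

lemma word_invariant:
  assumes "xs \<in> lists S" "ys \<in> lists S" "word_prod W xs = word_prod W ys"
    and inv: "\<And>n us vs s t. \<lbrakk>us \<in> lists S; vs \<in> lists S; s \<in> S; t \<in> S;
        word_prod W (concat (replicate n [s, t])) = \<one>\<rbrakk>
      \<Longrightarrow> f (us @ concat (replicate n [s, t]) @ vs) = f (us @ vs)"
  shows "f xs = f ys"
proof -
  obtain m where m: "coxeter_matrix S m" "\<forall>xs\<in>lists S. \<forall>ys\<in>lists S.
         word_prod W xs = word_prod W ys \<longleftrightarrow> equivclp (coxeter_deletion S m) xs ys"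
    using presentation by blast
  have del: "f us = f vs" if "coxeter_deletion S m us vs" for us vs
    using that by cases (auto intro: inv word_prod_eq_if_deletion[OF m])
  have "equivclp (coxeter_deletion S m) xs ys"
    using assms m by blast
  then show ?thesis
    by (induction rule: equivclp_induct) (auto dest: del)
qed

text \<open>Relators have even length; this is the sign character. It later excludes
  \<open>len (x \<otimes> s) = len x\<close>.\<close>

lemma even_length_eq:
  assumes "xs \<in> lists S" "ys \<in> lists S" "word_prod W xs = word_prod W ys"
  shows "even (length xs) \<longleftrightarrow> even (length ys)"
proof (rule word_invariant[OF assms])
  show "even (length (us @ concat (replicate n [s, t]) @ vs)) = even (length (us @ vs))"
    for n :: nat and us vs :: "'a list" and s t :: 'a
    by (induction n) auto
qed

lemma reduced_word:
  assumes "x \<in> carrier W"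
  obtains xs where "xs \<in> lists S" "length xs = len x" "word_prod W xs = x"
proof -
  have "\<exists>n. \<exists>xs\<in>lists S. length xs = n \<and> word_prod W xs = x"
    using word_exists[OF assms] by blast
  from LeastI_ex[OF this] show thesis
    using that unfolding len_def by blast
qed

lemma len_word_le: "xs \<in> lists S \<Longrightarrow> len (word_prod W xs) \<le> length xs"
  unfolding len_def by (rule Least_le) auto

lemma even_len_word: "xs \<in> lists S \<Longrightarrow> even (len (word_prod W xs)) \<longleftrightarrow> even (length xs)"
  by (metis even_length_eq reduced_word word_prod_closed)

lemma len_one [simp]: "len \<one> = 0"
  using len_word_le[of "[]"] by simp

lemma len_eq_0_iff [simp]: "x \<in> carrier W \<Longrightarrow> len x = 0 \<longleftrightarrow> x = \<one>"
  by (metis len_one length_0_conv reduced_word word_prod_Nil)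

lemma len_mult_le: "\<lbrakk>x \<in> carrier W; y \<in> carrier W\<rbrakk> \<Longrightarrow> len (x \<otimes> y) \<le> len x + len y"
  by (metis append_in_lists_conv len_word_le length_append reduced_word word_prod_append)

lemma even_len_mult:
  "\<lbrakk>x \<in> carrier W; y \<in> carrier W\<rbrakk> \<Longrightarrow> even (len (x \<otimes> y)) \<longleftrightarrow> even (len x + len y)"
  by (metis append_in_lists_conv even_len_word length_append reduced_word word_prod_append)

lemma len_inv [simp]: 
  assumes "x \<in> carrier W"
  shows "len (inv x) = len x"
proof -
  have "len (inv y) \<le> len y" if "y \<in> carrier W" for y
    by (metis that in_lists_conv_set inv_word_prod len_word_le length_rev reduced_word set_rev)
  from this[of x] this[of "inv x"] assms show ?thesis by simp
qed

lemma len_gen [simp]: "s \<in> S \<Longrightarrow> len s = 1"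
  using len_word_le[of "[s]"] even_len_word[of "[s]"] by (auto simp: le_Suc_eq)

lemma gen_neq_one [simp]: "s \<in> S \<Longrightarrow> s \<noteq> \<one>"
  using len_gen[of s] by fastforce

lemma len_eq_1_iff: "x \<in> carrier W \<Longrightarrow> len x = 1 \<longleftrightarrow> x \<in> S"
proof
  assume "x \<in> carrier W" "len x = 1"
  then obtain xs where xs: "xs \<in> lists S" "length xs = 1" "word_prod W xs = x"
    by (metis reduced_word)
  then obtain a where "xs = [a]" by (auto simp: length_Suc_conv)
  with xs show "x \<in> S" by auto
qed simp

lemma len_mult_gen_cases:
  assumes "x \<in> carrier W" "s \<in> S"
  shows "len (x \<otimes> s) = Suc (len x) \<or> len x = Suc (len (x \<otimes> s))"
proof -
  have "len (x \<otimes> s) \<le> Suc (len x)" 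
    using len_mult_le[of x s] assms by simp
  moreover have "len x \<le> Suc (len (x \<otimes> s))"
    using len_mult_le[of "x \<otimes> s" s] assms by simp
  moreover have "len (x \<otimes> s) \<noteq> len x"
    using even_len_mult[of x s] assms by auto
  ultimately show ?thesis by linarith
qed

subsection \<open>The exchange condition\<close>

text \<open>The multiplicity of \<open>t\<close> among the reflections \<open>s\<^sub>1 \<cdots> s\<^sub>i \<cdots> s\<^sub>1\<close> of the word
  \<open>s\<^sub>1 \<cdots> s\<^sub>k\<close>.  Its parity depends only on the product of the word.\<close>

primrec refl_count :: "'a list \<Rightarrow> 'a \<Rightarrow> nat" where
  "refl_count [] t = 0"
| "refl_count (x # xs) t = of_bool (t = x) + refl_count xs (x \<otimes> t \<otimes> x)"

lemma refl_count_append: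
  "\<lbrakk>xs \<in> lists S; ys \<in> lists S; t \<in> carrier W\<rbrakk> \<Longrightarrow>
     refl_count (xs @ ys) t =
       refl_count xs t + refl_count ys (inv (word_prod W xs) \<otimes> t \<otimes> word_prod W xs)"
  by (induction xs arbitrary: t) (auto simp: inv_mult_group m_assoc)

lemma conj_eq_iff:
  assumes "s \<in> S" "x \<in> carrier W" "y \<in> carrier W"
  shows "s \<otimes> x \<otimes> s = y \<longleftrightarrow> x = s \<otimes> y \<otimes> s"
  using assms by (auto simp: m_assoc)

text \<open>The reflections met along the word \<open>s t s t ...\<close> are \<open>s\<close>,
  \<open>s t s\<close>, \<open>s t s t s\<close> and so on, one for each of its \<open>2 * n\<close>
  letters.\<close>

lemma refl_count_relator:
  assumes "s \<in> S" "t \<in> S" "x \<in> carrier W"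
  shows "refl_count (concat (replicate n [s, t])) x = (\<Sum>j<2*n. of_bool (x = (s \<otimes> t) [^] j \<otimes> s))"
  using assms(3)
proof (induction n arbitrary: x)
  case (Suc n)
  have "(t \<otimes> (s \<otimes> x \<otimes> s) \<otimes> t = (s \<otimes> t) [^] j \<otimes> s) = (x = (s \<otimes> t) [^] Suc (Suc j) \<otimes> s)" for j :: nat
  proof -
    have "(t \<otimes> (s \<otimes> x \<otimes> s) \<otimes> t = (s \<otimes> t) [^] j \<otimes> s) 
      \<longleftrightarrow> x = s \<otimes> (t \<otimes> ((s \<otimes> t) [^] j \<otimes> s) \<otimes> t) \<otimes> s"
      using assms Suc.prems by (simp add: conj_eq_iff)
    also have "s \<otimes> (t \<otimes> ((s \<otimes> t) [^] j \<otimes> s) \<otimes> t) \<otimes> s = (s \<otimes> t) \<otimes> (s \<otimes> t) [^] j \<otimes> (s \<otimes> t) \<otimes> s"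
      using assms by (simp add: m_assoc)
    also have "(s \<otimes> t) \<otimes> (s \<otimes> t) [^] j = (s \<otimes> t) [^] Suc j"
      using assms by (simp only: nat_pow_Suc2 m_closed gen_closed)
    finally show ?thesis using assms by simp
  qed
  moreover have "(s \<otimes> x \<otimes> s = t) = (x = (s \<otimes> t) [^] (1::nat) \<otimes> s)"
    using assms Suc.prems by (simp add: conj_eq_iff)
  ultimately show ?case
    using assms Suc.prems by (simp add: Suc.IH sum.lessThan_Suc_shift del: sum.lessThan_Suc nat_pow_Suc)
qed simp

lemma word_prod_relator:
  "\<lbrakk>s \<in> S; t \<in> S\<rbrakk> \<Longrightarrow> word_prod W (concat (replicate n [s, t])) = (s \<otimes> t) [^] n"
proof (induction n)
  case (Suc n)
  then have "word_prod W (concat (replicate (Suc n) [s, t])) = (s \<otimes> t) \<otimes> (s \<otimes> t) [^] n"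
    by (simp add: m_assoc)
  also have "\<dots> = (s \<otimes> t) [^] Suc n"
    using Suc.prems by (simp only: nat_pow_Suc2 m_closed gen_closed)
  finally show ?case .
qed simp

text \<open>If \<open>(s \<otimes> t) [^] n = \<one>\<close>, the list of \<open>2 * n\<close>
  reflections has period \<open>n\<close>, so every reflection is met an even number of
  times.\<close>

lemma even_refl_count_relator:
  assumes "s \<in> S" "t \<in> S" "x \<in> carrier W" "word_prod W (concat (replicate n [s, t])) = \<one>"
  shows "even (refl_count (concat (replicate n [s, t])) x)"
proof -
  let ?f = "\<lambda>j::nat. of_bool (x = (s \<otimes> t) [^] j \<otimes> s) :: nat"
  have "(s \<otimes> t) [^] n = \<one>"
    using assms word_prod_relator by simp
  then have *: "?f (n + j) = ?f j" for j
    using assms by (simp flip: nat_pow_mult)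
  have "sum ?f {..<2*n} = sum ?f {..<n} + (\<Sum>j<n. ?f (n + j))"
  proof -
    have "sum ?f {..<n + k} = sum ?f {..<n} + (\<Sum>j<k. ?f (n + j))" for k
      by (induction k) auto
    from this[of n] show ?thesis by (simp only: mult_2)
  qed
  then show ?thesis
    unfolding refl_count_relator[OF assms(1-3)] * by simp
qed

lemma inv_cancel_left [simp]:
  "\<lbrakk>g \<in> carrier W; x \<in> carrier W\<rbrakk> \<Longrightarrow> inv g \<otimes> (g \<otimes> x) = x"
  "\<lbrakk>g \<in> carrier W; x \<in> carrier W\<rbrakk> \<Longrightarrow> g \<otimes> (inv g \<otimes> x) = x"
  by (simp_all flip: m_assoc)

lemma even_refl_count_eq:
  assumes "xs \<in> lists S" "ys \<in> lists S" "word_prod W xs = word_prod W ys" "t \<in> carrier W"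
  shows "even (refl_count xs t) \<longleftrightarrow> even (refl_count ys t)"
proof (rule word_invariant[OF assms(1-3)])
  fix n us vs s u
  assume *: "us \<in> lists S" "vs \<in> lists S" "s \<in> S" "u \<in> S"
    and r: "word_prod W (concat (replicate n [s, u])) = \<one>"
  let ?r = "concat (replicate n [s, u])" and ?x = "inv (word_prod W us) \<otimes> t \<otimes> word_prod W us"
  have "?r \<in> lists S" "?x \<in> carrier W"
    using * assms by (auto simp: in_lists_conv_set)
  moreover have "even (refl_count ?r ?x)"
    using * r assms by (intro even_refl_count_relator) auto
  ultimately show "even (refl_count (us @ ?r @ vs) t) = even (refl_count (us @ vs) t)"
    using * r assms by (simp add: refl_count_append)
qed

text \<open>When \<open>t\<close> is the reflection attached to a position of the word, left
  multiplication by \<open>t\<close> erases the letter at that position.\<close>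

lemma refl_count_pos:
  assumes "xs \<in> lists S" "t \<in> carrier W" "refl_count xs t > 0"
  shows "\<exists>us x vs. xs = us @ x # vs \<and> t \<otimes> word_prod W xs = word_prod W (us @ vs)"
  using assms
proof (induction xs arbitrary: t)
  case (Cons x xs)
  then have x: "x \<in> S" "xs \<in> lists S" by auto
  show ?case
  proof (cases "t = x")
    case True
    then have "x # xs = [] @ x # xs \<and> t \<otimes> word_prod W (x # xs) = word_prod W ([] @ xs)"
      using x by simp
    then show ?thesis by blast
  next
    case False
    then have "refl_count xs (x \<otimes> t \<otimes> x) > 0"
      using Cons.prems by simp
    with Cons.IH[of "x \<otimes> t \<otimes> x"] x Cons.prems obtain us y vs where
      *: "xs = us @ y # vs" "x \<otimes> t \<otimes> x \<otimes> word_prod W xs = word_prod W (us @ vs)"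
      by auto
    have "x # xs = (x # us) @ y # vs" using * by simp
    moreover have "t \<otimes> word_prod W (x # xs) = x \<otimes> (x \<otimes> t \<otimes> x \<otimes> word_prod W xs)"
      using x Cons.prems by (simp add: m_assoc)
    with * have "t \<otimes> word_prod W (x # xs) = word_prod W ((x # us) @ vs)"
      by simp
    ultimately show ?thesis by blast
  qed
qed simp

lemma reflections_closed: "t \<in> reflections \<Longrightarrow> t \<in> carrier W"
  by (auto simp: reflections_def)

lemma reflection_square: "t \<in> reflections \<Longrightarrow> t \<otimes> t = \<one>"
  by (auto simp: reflections_def m_assoc)

lemma reflection_conj:
  assumes "t \<in> reflections" "g \<in> carrier W"
  shows "g \<otimes> t \<otimes> inv g \<in> reflections"
proof -
  obtain h s where "h \<in> carrier W" "s \<in> S" "t = h \<otimes> s \<otimes> inv h"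
    using assms by (auto simp: reflections_def)
  then have "g \<otimes> t \<otimes> inv g = (g \<otimes> h) \<otimes> s \<otimes> inv (g \<otimes> h)" "g \<otimes> h \<in> carrier W"
    using assms by (auto simp: m_assoc inv_mult_group)
  with \<open>s \<in> S\<close> show ?thesis
    unfolding reflections_def by blast
qed

lemma gen_reflection: "s \<in> S \<Longrightarrow> s \<in> reflections"
  unfolding reflections_def by (intro CollectI exI[of _ \<one>] exI[of _ s]) auto

lemma odd_len_reflection: "t \<in> reflections \<Longrightarrow> odd (len t)"
  by (auto simp: reflections_def even_len_mult)

text \<open>The word \<open>g s g\<^sup>-\<^sup>1\<close> is a palindrome: \<open>t\<close> occurs in its middle, and the other occurrences are
  paired off by symmetry.\<close>

lemma reflection_word:
  assumes "t \<in> reflections"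
  obtains ts where "ts \<in> lists S" "word_prod W ts = t" "odd (refl_count ts t)"
proof -
  obtain g s where g: "g \<in> carrier W" and s: "s \<in> S" and t: "t = g \<otimes> s \<otimes> inv g"
    using assms by (auto simp: reflections_def)
  obtain gs where gs: "gs \<in> lists S" "word_prod W gs = g"
    using reduced_word[OF g] by blast
  have rev: "rev gs \<in> lists S" "word_prod W (rev gs) = inv g"
    using gs inv_word_prod[of gs] by (auto simp: in_lists_conv_set)
  have tc: "t \<in> carrier W" using g s t by simp
  have ginv: "inv g \<otimes> t \<otimes> g = s"
    using g s t by (simp add: m_assoc inv_cancel_left)
  have "even (refl_count (gs @ rev gs) t) = even (refl_count [] t)"
    by (rule even_refl_count_eq) (use gs rev g tc in auto)
  then have "even (refl_count gs t + refl_count (rev gs) s)"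
    using gs rev g tc ginv by (simp add: refl_count_append)
  then have "odd (refl_count (gs @ [s] @ rev gs) t)"
    using gs rev g tc ginv s by (simp add: refl_count_append)
  moreover have "gs @ [s] @ rev gs \<in> lists S" "word_prod W (gs @ [s] @ rev gs) = t"
    using gs rev s t g by (auto simp: m_assoc)
  ultimately show thesis using that by blast
qed

text \<open>A reduced word \<open>ys\<close> of the shorter element does not meet \<open>t\<close>:
  erasing a letter would give a word of \<open>?w\<close> of length below
  \<open>len (t \<otimes> ?w)\<close>. Putting a word of \<open>t\<close> that meets
  \<open>t\<close> oddly often in front of \<open>ys\<close> gives a word of \<open>?w\<close> with
  odd count, and the parity carries over to \<open>xs\<close>.\<close>

theorem strong_exchange:
  assumes t: "t \<in> reflections" and xs: "xs \<in> lists S"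
    and less: "len (t \<otimes> word_prod W xs) < len (word_prod W xs)"
  shows "\<exists>us x vs. xs = us @ x # vs \<and> t \<otimes> word_prod W xs = word_prod W (us @ vs)"
proof -
  let ?w = "word_prod W xs"
  have tc: "t \<in> carrier W" using t reflections_closed by blast
  have w: "t \<otimes> (t \<otimes> ?w) = ?w"
    using reflection_square[OF t] tc xs by (simp flip: m_assoc)
  obtain ys where ys: "ys \<in> lists S" "length ys = len (t \<otimes> ?w)" "word_prod W ys = t \<otimes> ?w"
    using reduced_word[of "t \<otimes> ?w"] tc xs by blast
  obtain ts where ts: "ts \<in> lists S" "word_prod W ts = t" "odd (refl_count ts t)"
    using reflection_word[OF t] by blast
  have "refl_count ys t = 0"
  proof (rule ccontr)
    assume "refl_count ys t \<noteq> 0"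
    then obtain us x vs where *: "ys = us @ x # vs" "t \<otimes> word_prod W ys = word_prod W (us @ vs)"
      using refl_count_pos[OF ys(1) tc] by blast
    then have "len ?w \<le> length (us @ vs)"
      using len_word_le[of "us @ vs"] ys w by simp
    with less ys * show False by simp
  qed
  moreover have "inv t \<otimes> t \<otimes> t = t"
    using tc by simp
  ultimately have "odd (refl_count (ts @ ys) t)"
    using ts ys tc by (simp add: refl_count_append)
  moreover have "word_prod W (ts @ ys) = ?w"
    using ts ys w by simp
  ultimately have "odd (refl_count xs t)"
    using even_refl_count_eq[of "ts @ ys" xs t] ts ys xs tc by simp
  then show ?thesis
    using refl_count_pos[OF xs tc] by (cases "refl_count xs t") auto
qed

lemma exchange_right:
  assumes xs: "xs \<in> lists S" and r: "t \<in> reflections"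
    and less: "len (word_prod W xs \<otimes> t) < len (word_prod W xs)"
  shows "\<exists>us x vs. xs = us @ x # vs \<and> word_prod W xs \<otimes> t = word_prod W (us @ vs)"
proof -
  let ?w = "word_prod W xs"
  let ?t = "?w \<otimes> t \<otimes> inv ?w"
  have "?t \<in> reflections"
    using r xs reflection_conj by auto
  moreover have "?t \<otimes> ?w = ?w \<otimes> t"
    using r reflections_closed xs by (simp add: m_assoc)
  ultimately show ?thesis
    using strong_exchange[of ?t xs] less xs by auto
qed

subsection \<open>The Bruhat order\<close>

lemma bruhat_le_carrier: "x \<preceq> y \<Longrightarrow> x \<in> carrier W \<and> y \<in> carrier W"
proof -
  assume "x \<preceq> y"
  then have x: "x \<in> carrier W" and "bruhat_step\<^sup>*\<^sup>* x y" by (auto simp: bruhat_le_def)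
  from this(2) x show ?thesis
    by (induction rule: rtranclp_induct) (auto simp: bruhat_step_def reflections_closed)
qed

lemma bruhat_le_refl [simp, intro]: "x \<in> carrier W \<Longrightarrow> x \<preceq> x"
  by (simp add: bruhat_le_def)

lemma bruhat_le_trans [trans]: "x \<preceq> y \<Longrightarrow> y \<preceq> z \<Longrightarrow> x \<preceq> z"
  by (auto simp: bruhat_le_def)

lemma bruhat_le_step: "\<lbrakk>x \<in> carrier W; t \<in> reflections; len x < len (x \<otimes> t)\<rbrakk> \<Longrightarrow> x \<preceq> x \<otimes> t"
  by (auto simp: bruhat_le_def bruhat_step_def intro!: r_into_rtranclp)

lemma bruhat_le_len: "x \<preceq> y \<Longrightarrow> len x \<le> len y \<and> (len x = len y \<longrightarrow> x = y)"
proof -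
  assume "x \<preceq> y"
  then have "bruhat_step\<^sup>*\<^sup>* x y" by (auto simp: bruhat_le_def)
  then show ?thesis
    by (induction rule: rtranclp_induct) (auto simp: bruhat_step_def)
qed

lemma bruhat_le_antisym: "x \<preceq> y \<Longrightarrow> y \<preceq> x \<Longrightarrow> x = y"
  by (metis bruhat_le_len le_antisym)

lemma bruhat_le_gen: "\<lbrakk>x \<in> carrier W; s \<in> S; len x < len (x \<otimes> s)\<rbrakk> \<Longrightarrow> x \<preceq> x \<otimes> s"
  using bruhat_le_step gen_reflection by blast

lemma bruhat_le_gen': "\<lbrakk>x \<in> carrier W; s \<in> S; len (x \<otimes> s) < len x\<rbrakk> \<Longrightarrow> x \<otimes> s \<preceq> x"
  using bruhat_le_gen[of "x \<otimes> s" s] by simp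

text \<open>The elements \<open>x \<otimes> s\<close> and \<open>y \<otimes> s\<close> differ by the
  conjugate reflection \<open>s t s\<close>, hence have different lengths by parity. If
  \<open>x \<otimes> s\<close> is the longer one, exchange in a reduced word of \<open>x\<close>
  followed by \<open>s\<close> either erases that final \<open>s\<close>, so that
  \<open>x \<otimes> s = y\<close>, or yields a word of \<open>y\<close> that is too short.\<close>

lemma bruhat_step_mult_gen:
  assumes step: "bruhat_step x y" and s: "s \<in> S"
  shows "x \<otimes> s \<preceq> y \<or> x \<otimes> s \<preceq> y \<otimes> s"
proof -
  obtain t where x: "x \<in> carrier W" and t: "t \<in> reflections" and y: "y = x \<otimes> t"
    and less: "len x < len y"
    using step by (auto simp: bruhat_step_def)
  have tc: "t \<in> carrier W" using t reflections_closed by blast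
  let ?t = "s \<otimes> t \<otimes> s"
  have t': "?t \<in> reflections"
    using reflection_conj[OF t gen_closed[OF s]] s by simp
  have ys: "y \<otimes> s = (x \<otimes> s) \<otimes> ?t"
    using x s tc y by (simp add: m_assoc)
  have xs: "x \<otimes> s = (y \<otimes> s) \<otimes> ?t"
  proof -
    have "(y \<otimes> s) \<otimes> ?t = x \<otimes> (t \<otimes> t) \<otimes> s"
      using x s tc y by (simp add: m_assoc)
    then show ?thesis using x reflection_square[OF t] by simp
  qed
  consider "len (x \<otimes> s) < len (y \<otimes> s)" | "len (y \<otimes> s) < len (x \<otimes> s)"
    using odd_len_reflection[OF t'] even_len_mult[of "x \<otimes> s" ?t] x s tc ys
    by (metis even_add gen_closed linorder_neqE_nat m_closed)
  then show ?thesis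
  proof cases
    case 1
    then show ?thesis
      using bruhat_le_step[of "x \<otimes> s" ?t] x s t' ys by auto
  next
    case 2
    obtain ws where ws: "ws \<in> lists S" "length ws = len x" "word_prod W ws = x"
      using reduced_word x by blast
    then have xs': "word_prod W (ws @ [s]) = x \<otimes> s"
      using s by simp
    have "len (x \<otimes> s \<otimes> ?t) < len (x \<otimes> s)"
      using 2 ys by simp
    then obtain us a vs where *: "ws @ [s] = us @ a # vs" "y \<otimes> s = word_prod W (us @ vs)"
      using exchange_right[of "ws @ [s]" ?t] ws s t' xs' ys by auto
    show ?thesis
    proof (cases vs rule: rev_cases)
      case Nil
      with * ws have "y \<otimes> s = x" by auto
      then have "x \<otimes> s = y \<otimes> s \<otimes> s" by simp
      also have "\<dots> = y" using s x y tc by (intro gen_cancel_right) auto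
      finally have "x \<otimes> s = y" .
      then show ?thesis using x s by auto
    next
      case (snoc vs' b)
      with * have ws': "ws = us @ a # vs'" "b = s" by auto
      with ws have "us @ vs' \<in> lists S" by auto
      moreover have "y \<otimes> s = word_prod W (us @ vs') \<otimes> s"
        using * ws' snoc s ws by (simp add: m_assoc)
      then have "y = word_prod W (us @ vs')"
        using s y x tc calculation by (metis gen_cancel_right m_closed word_prod_closed)
      ultimately have "len y \<le> length (us @ vs')"
        using len_word_le by blast
      with less ws ws' show ?thesis by simp
    qed
  qed
qed

lemma bruhat_le_mult_gen:
  assumes "x \<preceq> y" and s: "s \<in> S"
  shows "x \<otimes> s \<preceq> y \<or> x \<otimes> s \<preceq> y \<otimes> s"
proof -
  have "bruhat_step\<^sup>*\<^sup>* x y" and x: "x \<in> carrier W"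
    using assms by (auto simp: bruhat_le_def)
  then show ?thesis
  proof (induction rule: rtranclp_induct)
    case (step y z)
    then have "y \<preceq> z" unfolding bruhat_le_def using bruhat_step_def by blast
    with step bruhat_step_mult_gen[OF step(2) s] bruhat_le_trans show ?case by blast
  qed (use s in auto)
qed

lemma subseq_lists: "subseq xs ys \<Longrightarrow> ys \<in> lists J \<Longrightarrow> xs \<in> lists J"
  by (induction rule: list_emb.induct) auto

lemma subseq_delete: "subseq (us @ vs) (us @ a # vs)"
  by (simp add: subseq_append' list_emb_Cons)

lemma subseq_snoc:
  assumes "subseq xs (ys @ [s])"
  shows "subseq xs ys \<or> (\<exists>xs'. xs = xs' @ [s] \<and> subseq xs' ys)"
proof -
  have "vs = [] \<or> vs = [s]" if "subseq vs [s]" for vs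
    using that by (cases vs) (simp_all split: if_splits)
  then show ?thesis
    using assms unfolding subseq_append_iff by (metis append_Nil2)
qed

text \<open>Every step down is multiplication by a reflection that shortens, so it erases one letter
  of the subword found so far. Here \<open>ys\<close> is an arbitrary word, whereas the converse
  \<open>le_of_subword\<close> fails for unreduced words such as \<open>s s\<close>.\<close>

lemma subword_of_le:
  assumes "x \<preceq> word_prod W ys" "ys \<in> lists S"
  shows "\<exists>xs. subseq xs ys \<and> word_prod W xs = x"
proof -
  have "bruhat_step\<^sup>*\<^sup>* x (word_prod W ys)"
    using assms by (auto simp: bruhat_le_def)
  then show ?thesis
  proof (induction rule: converse_rtranclp_induct)
    case (step x z)
    then obtain zs where zs: "subseq zs ys" "word_prod W zs = z" by blast
    then have zsS: "zs \<in> lists S"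
      using assms(2) subseq_lists by blast
    obtain t where t: "t \<in> reflections" "z = x \<otimes> t" "len x < len z" "x \<in> carrier W"
      using step by (auto simp: bruhat_step_def)
    then have x: "x = word_prod W zs \<otimes> t"
      unfolding zs(2) using reflection_square[OF t(1)] reflections_closed[OF t(1)] by (simp add: m_assoc)
    have "len (word_prod W zs \<otimes> t) < len (word_prod W zs)"
      using t(3) x zs(2) by simp
    then obtain us a vs where *: "zs = us @ a # vs" "word_prod W zs \<otimes> t = word_prod W (us @ vs)"
      using exchange_right[OF zsS t(1)] by blast
    have "subseq (us @ vs) zs"
      unfolding *(1) by (rule subseq_delete)
    moreover have "word_prod W (us @ vs) = x"
      using x *(2) by simp
    ultimately show ?case
      using subseq_order.order_trans[OF _ zs(1)] by (intro exI[of _ "us @ vs"]) simp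
  qed auto
qed

lemma le_of_subword:
  assumes "ys \<in> lists S" "length ys = len (word_prod W ys)" "subseq xs ys"
  shows "word_prod W xs \<preceq> word_prod W ys"
  using assms
proof (induction ys arbitrary: xs rule: rev_induct)
  case (snoc s ys)
  then have s: "s \<in> S" and ys: "ys \<in> lists S" by auto
  let ?y = "word_prod W ys"
  have len: "length ys = len ?y"
    using snoc.prems(2) len_mult_le[of ?y s] len_word_le[OF ys] s ys by simp
  have le: "?y \<preceq> ?y \<otimes> s"
    using bruhat_le_gen[of ?y s] snoc.prems(2) len s ys by simp
  from snoc.prems(3) consider "subseq xs ys" | xs' where "xs = xs' @ [s]" "subseq xs' ys"
    using subseq_snoc[OF snoc.prems(3)] by blast
  then show ?case
  proof cases
    case 1
    then show ?thesis
      using snoc.IH[OF ys len 1] le bruhat_le_trans s ys by simp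
  next
    case 2
    then have xs': "xs' \<in> lists S" using subseq_lists ys by blast
    have "word_prod W xs' \<preceq> ?y"
      using snoc.IH[OF ys len 2(2)] .
    then have "word_prod W xs' \<otimes> s \<preceq> ?y \<or> word_prod W xs' \<otimes> s \<preceq> ?y \<otimes> s"
      using bruhat_le_mult_gen s by blast
    then have "word_prod W xs' \<otimes> s \<preceq> ?y \<otimes> s"
      using le bruhat_le_trans by blast
    then show ?thesis
      using 2(1) s ys xs' by simp
  qed
qed (auto dest: list_emb_Nil2)

lemma reduced_subword:
  assumes "ys \<in> lists S"
  shows "\<exists>xs. subseq xs ys \<and> word_prod W xs = word_prod W ys \<and> length xs = len (word_prod W ys)"
  using assms
proof (induction ys rule: rev_induct)
  case (snoc s ys)
  then have s: "s \<in> S" and ys: "ys \<in> lists S" by auto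
  then obtain xs where xs: "subseq xs ys" "word_prod W xs = word_prod W ys" 
    "length xs = len (word_prod W ys)"
    using snoc.IH by blast
  have xsS: "xs \<in> lists S" using subseq_lists xs(1) ys by blast
  show ?case
  proof (cases "len (word_prod W ys \<otimes> s) < len (word_prod W ys)")
    case False
    then have "len (word_prod W ys \<otimes> s) = Suc (len (word_prod W ys))"
      using len_mult_gen_cases[of "word_prod W ys" s] s ys by auto
    moreover have "subseq (xs @ [s]) (ys @ [s])"
      using xs by simp
    ultimately show ?thesis
      using xs s ys xsS by (intro exI[of _ "xs @ [s]"]) simp
  next
    case True
    then obtain us a vs where *: "xs = us @ a # vs" "word_prod W ys \<otimes> s = word_prod W (us @ vs)"
      using exchange_right[OF xsS gen_reflection[OF s]] xs by auto
    have "len (word_prod W ys) = Suc (len (word_prod W ys \<otimes> s))"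
      using True len_mult_gen_cases[of "word_prod W ys" s] s ys by auto
    then have "length (us @ vs) = len (word_prod W ys \<otimes> s)"
      using * xs by simp
    moreover have "subseq (us @ vs) (us @ a # vs)" by (rule subseq_delete)
    then have "subseq (us @ vs) (ys @ [s])"
      using * xs by (meson prefixI prefix_imp_subseq subseq_order.order_trans)
    ultimately show ?thesis
      using * s ys by (intro exI[of _ "us @ vs"]) simp
  qed
qed simp

lemma one_le [simp]: "x \<in> carrier W \<Longrightarrow> \<one> \<preceq> x"
  using le_of_subword[of _ "[]"] reduced_word[of x] by (metis list_emb_Nil word_prod_Nil)

lemma exists_right_descent:
  assumes "x \<in> carrier W" "x \<noteq> \<one>"
  obtains r where "r \<in> S" "len x = Suc (len (x \<otimes> r))"
proof -
  obtain xs where xs: "xs \<in> lists S" "length xs = len x" "word_prod W xs = x"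
    using reduced_word assms by blast
  with assms obtain ys r where ys: "xs = ys @ [r]"
    by (cases xs rule: rev_cases) auto
  then have r: "r \<in> S" "ys \<in> lists S" using xs by auto
  then have "x = word_prod W ys \<otimes> r" using xs ys by simp
  then have "x \<otimes> r = word_prod W ys" using r by simp
  then have "len (x \<otimes> r) \<le> length ys" using r len_word_le by simp
  then have "len (x \<otimes> r) < len x" using xs ys by simp
  then show thesis using that[OF r(1)] len_mult_gen_cases[OF assms(1) r(1)] by auto
qed

lemma lifting:
  assumes le: "x \<preceq> y" and s: "s \<in> S" and "len (y \<otimes> s) < len y" "len x < len (x \<otimes> s)"
  shows "x \<preceq> y \<otimes> s" "x \<otimes> s \<preceq> y"
proof -
  have x: "x \<in> carrier W" and y: "y \<in> carrier W" using bruhat_le_carrier[OF le] by auto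
  obtain zs where zs: "zs \<in> lists S" "length zs = len (y \<otimes> s)" "word_prod W zs = y \<otimes> s"
    using reduced_word[of "y \<otimes> s"] s y by blast
  have "word_prod W (zs @ [s]) = y" using zs s y by simp
  then obtain xs where xs: "subseq xs (zs @ [s])" "word_prod W xs = x"
    using subword_of_le[of x "zs @ [s]"] le zs s by auto
  have below: "word_prod W us \<preceq> y \<otimes> s" if "subseq us zs" for us
    using le_of_subword[of zs us] zs that by simp
  show *: "x \<preceq> y \<otimes> s"
    using subseq_snoc[OF xs(1)]
  proof
    assume "subseq xs zs"
    then show ?thesis using below xs by blast
  next
    assume "\<exists>xs'. xs = xs' @ [s] \<and> subseq xs' zs"
    then obtain xs' where xs': "xs = xs' @ [s]" "subseq xs' zs" by blast
    then have "xs' \<in> lists S" using subseq_lists zs(1) by blast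
    then have "x = word_prod W xs' \<otimes> s" using xs xs' s by simp
    then have "x \<otimes> s = word_prod W xs'" using s \<open>xs' \<in> lists S\<close> by simp
    then have "x \<otimes> s \<preceq> y \<otimes> s" using below xs' by simp
    moreover have "x \<preceq> x \<otimes> s" using bruhat_le_gen x s assms by blast
    ultimately show ?thesis using bruhat_le_trans by blast
  qed
  have "y \<otimes> s \<preceq> y" using bruhat_le_gen'[OF y s] assms by blast
  then show "x \<otimes> s \<preceq> y"
    using bruhat_le_mult_gen[OF * s] s y bruhat_le_trans by auto
qed

text \<open>The Bruhat order is graded, which lets the covers in a matching be tested by length. Let
  \<open>s\<close> be a right descent of \<open>y\<close>. If \<open>x \<otimes> s\<close> is longer
  than \<open>x\<close>, it lies below \<open>y\<close> by lifting. Otherwise induction gives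
  \<open>z\<close> between \<open>x \<otimes> s\<close> and \<open>y \<otimes> s\<close>, one step
  above \<open>x \<otimes> s\<close>; then \<open>z \<otimes> s\<close> works unless
  \<open>z = x\<close>. In that case \<open>x\<close> lies below \<open>y \<otimes> s\<close>, so
  either \<open>x = y \<otimes> s\<close> and \<open>y\<close> itself works, or induction applies
  once more.\<close>

lemma chain_property:
  assumes "x \<preceq> y" "x \<noteq> y"
  shows "\<exists>z. x \<preceq> z \<and> z \<preceq> y \<and> len z = Suc (len x)"
  using assms
proof (induction "len y" arbitrary: x y rule: less_induct)
  case less
  have x: "x \<in> carrier W" and y: "y \<in> carrier W" 
    using bruhat_le_carrier[OF less.prems(1)] by auto
  have lt: "len x < len y" using bruhat_le_len less.prems by force
  then have "y \<noteq> \<one>" by auto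
  with y obtain s where s: "s \<in> S" "len y = Suc (len (y \<otimes> s))"
    using exists_right_descent by blast
  then have ys: "y \<otimes> s \<preceq> y" "len (y \<otimes> s) < len y" using bruhat_le_gen'[OF y] by auto
  consider (up) "len (x \<otimes> s) = Suc (len x)" | (down) "len x = Suc (len (x \<otimes> s))"
    using len_mult_gen_cases x s by blast
  then show ?case
  proof cases
    case up
    then have "x \<otimes> s \<preceq> y" using lifting[OF less.prems(1) s(1)] ys by simp
    moreover have "x \<preceq> x \<otimes> s" using bruhat_le_gen x s up by simp
    ultimately show ?thesis using up by blast
  next
    case down
    have c: "x \<otimes> s \<in> carrier W" using x s by simp
    have eq: "x \<otimes> s \<otimes> s = x" using x s by simp
    have "x \<otimes> s \<preceq> y" using bruhat_le_gen'[of x s] x s down less.prems bruhat_le_trans by auto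
    then have "x \<otimes> s \<preceq> y \<otimes> s" using lifting(1)[of "x \<otimes> s" y s] s ys down eq by simp
    moreover have "x \<otimes> s \<noteq> y \<otimes> s" using x y s less.prems by simp
    ultimately obtain z where z: "x \<otimes> s \<preceq> z" "z \<preceq> y \<otimes> s" "len z = Suc (len (x \<otimes> s))"
      using less.hyps[OF ys(2)] by blast
    have zc: "z \<in> carrier W" using bruhat_le_carrier[OF z(1)] by simp
    show ?thesis
    proof (cases "len z < len (z \<otimes> s)")
      case True
      have zy: "z \<preceq> y" using z ys bruhat_le_trans by blast
      have "z \<otimes> s \<preceq> y" using lifting(2)[OF zy s(1)] ys True by simp
      moreover have "x \<preceq> z \<or> x \<preceq> z \<otimes> s"
        using bruhat_le_mult_gen[OF z(1) s(1)] eq by simp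
      moreover have "x \<preceq> z \<Longrightarrow> x = z" using bruhat_le_len[of x z] z down by simp
      moreover have "z \<preceq> z \<otimes> s" using bruhat_le_gen[OF zc s(1) True] .
      moreover have "len (z \<otimes> s) = Suc (len x)"
        using len_mult_gen_cases[OF zc s(1)] True z down by auto
      ultimately show ?thesis by metis
    next
      case False
      then have "len (z \<otimes> s) < len z" using len_mult_gen_cases[OF zc s(1)] by auto
      then have "x \<preceq> z" using lifting(2)[OF z(1) s(1)] down eq by simp
      then have "x = z" using bruhat_le_len[of x z] z down by simp
      then have xys: "x \<preceq> y \<otimes> s" using z by simp
      show ?thesis
      proof (cases "x = y \<otimes> s")
        case True
        then show ?thesis using ys s y less.prems by (intro exI[of _ y]) auto
      next
        case False
        then obtain z' where "x \<preceq> z'" "z' \<preceq> y \<otimes> s" "len z' = Suc (len x)"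
          using less.hyps[OF ys(2) xys] by blast
        then show ?thesis using ys bruhat_le_trans by blast
      qed
    qed
  qed
qed

text \<open>A down-closed set contains all elements between two of its members, so its covers are
  covers of the whole group.\<close>

lemma covered_in_iff:
  assumes "\<And>z y. y \<in> P \<Longrightarrow> z \<preceq> y \<Longrightarrow> z \<in> P"
  shows "covered_in P x y \<longleftrightarrow> x \<in> P \<and> y \<in> P \<and> x \<preceq> y \<and> len y = Suc (len x)"
proof
  assume c: "covered_in P x y"
  then have xy: "x \<in> P" "y \<in> P" "x \<preceq> y" "x \<noteq> y" by (auto simp: covered_in_def)
  then obtain z where z: "x \<preceq> z" "z \<preceq> y" "len z = Suc (len x)"
    using chain_property by blast
  then have "z \<in> P" "x \<noteq> z" using assms xy by auto
  with c z have "z = y" by (auto simp: covered_in_def)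
  with xy z show "x \<in> P \<and> y \<in> P \<and> x \<preceq> y \<and> len y = Suc (len x)" by simp
next
  assume xy: "x \<in> P \<and> y \<in> P \<and> x \<preceq> y \<and> len y = Suc (len x)"
  have False if z: "x \<preceq> z" "x \<noteq> z" "z \<preceq> y" "z \<noteq> y" for z
    using bruhat_le_len[OF z(1)] bruhat_le_len[OF z(3)] xy z by linarith
  with xy show "covered_in P x y" unfolding covered_in_def by auto
qed

lemma covered_iff: "x \<lhd>\<^sub>B y \<longleftrightarrow> x \<preceq> y \<and> len y = Suc (len x)"
  using covered_in_iff[of "carrier W"] bruhat_le_carrier by blast

lemma lower_down_closed: "y \<in> lower v \<Longrightarrow> z \<preceq> y \<Longrightarrow> z \<in> lower v"
  unfolding lower_def using bruhat_le_carrier bruhat_le_trans by blast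

lemma covered_in_lower_iff:
  "covered_in (lower v) x y \<longleftrightarrow> x \<in> lower v \<and> y \<in> lower v \<and> x \<lhd>\<^sub>B y"
  using covered_in_iff[of "lower v"] lower_down_closed covered_iff by blast

lemma covered_reflection:
  assumes "x \<lhd>\<^sub>B y"
  obtains t where "t \<in> reflections" "y = x \<otimes> t"
proof -
  have xy: "x \<preceq> y" "len y = Suc (len x)" using assms by (auto simp: covered_iff)
  then have "bruhat_step\<^sup>*\<^sup>* x y" by (auto simp: bruhat_le_def)
  then show thesis
  proof (cases rule: converse_rtranclpE)
    case base
    then show ?thesis using xy by simp
  next
    case (step z)
    then obtain t where t: "t \<in> reflections" "z = x \<otimes> t" "len x < len z" "x \<in> carrier W"
      by (auto simp: bruhat_step_def)
    then have "z \<preceq> y" using step reflections_closed by (auto simp: bruhat_le_def)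
    then have "z = y" using bruhat_le_len[of z y] xy t by linarith
    then show ?thesis using that t by blast
  qed
qed

subsection \<open>Supports and parabolic subgroups\<close>

lemma Supp_subset_set: "xs \<in> lists S \<Longrightarrow> Supp (word_prod W xs) \<subseteq> set xs"
proof
  fix r assume xs: "xs \<in> lists S" and "r \<in> Supp (word_prod W xs)"
  then have r: "r \<in> S" "r \<preceq> word_prod W xs" by (auto simp: Supp_def)
  then obtain ys where ys: "subseq ys xs" "word_prod W ys = r"
    using subword_of_le xs by blast
  then have "ys \<in> lists S" using subseq_lists xs by blast
  then obtain zs where zs: "subseq zs ys" "word_prod W zs = r" "length zs = 1"
    using reduced_subword[of ys] ys r by auto
  then obtain a where "zs = [a]" by (auto simp: length_Suc_conv)
  moreover have "zs \<in> lists S" using zs(1) \<open>ys \<in> lists S\<close> subseq_lists by blast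
  ultimately have "zs = [r]" using zs by simp
  moreover have "zs \<in> lists (set xs)"
    by (rule subseq_lists[OF zs(1) subseq_lists[OF ys(1)]]) auto
  ultimately show "r \<in> set xs" by simp
qed

lemma Supp_reduced_word:
  assumes "xs \<in> lists S" "length xs = len (word_prod W xs)"
  shows "Supp (word_prod W xs) = set xs"
proof (rule antisym[OF Supp_subset_set[OF assms(1)]], rule subsetI)
  fix r assume r: "r \<in> set xs"
  then have "r \<in> S" using assms by (auto simp: in_lists_conv_set)
  moreover have "subseq [r] xs" using r by (simp add: subseq_singleton_left)
  then have "word_prod W [r] \<preceq> word_prod W xs"
    using le_of_subword assms by blast
  ultimately show "r \<in> Supp (word_prod W xs)" by (simp add: Supp_def)
qed

lemma Supp_subset_S: "Supp x \<subseteq> S"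
  by (auto simp: Supp_def)

text \<open>The letters of a reduced word are exactly the support of its value. Membership in a
  parabolic subgroup thus becomes a condition that is monotone in the Bruhat order, and it is nearly
  always tested in this form below.\<close>

lemma parabolic_iff:
  assumes "J \<subseteq> S"
  shows "x \<in> parabolic J \<longleftrightarrow> x \<in> carrier W \<and> Supp x \<subseteq> J"
proof
  assume "x \<in> parabolic J"
  then obtain xs where "xs \<in> lists J" "x = word_prod W xs"
    unfolding parabolic_def mem_generate_iff[OF assms] by blast
  moreover from this have "xs \<in> lists S" using assms by auto
  ultimately show "x \<in> carrier W \<and> Supp x \<subseteq> J"
    using Supp_subset_set[of xs] by (auto simp: in_lists_conv_set)
next
  assume x: "x \<in> carrier W \<and> Supp x \<subseteq> J"
  then obtain xs where xs: "xs \<in> lists S" "length xs = len x" "word_prod W xs = x"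
    using reduced_word by blast
  then have "set xs \<subseteq> J" using Supp_reduced_word[of xs] x by simp
  then have "xs \<in> lists J" by auto
  then show "x \<in> parabolic J"
    unfolding parabolic_def mem_generate_iff[OF assms] using xs by blast
qed

lemma Supp_mult: "\<lbrakk>x \<in> carrier W; y \<in> carrier W\<rbrakk> \<Longrightarrow> Supp (x \<otimes> y) \<subseteq> Supp x \<union> Supp y"
proof -
  assume xy: "x \<in> carrier W" "y \<in> carrier W"
  obtain xs ys where "xs \<in> lists S" "length xs = len x" "word_prod W xs = x"
    "ys \<in> lists S" "length ys = len y" "word_prod W ys = y"
    using xy reduced_word by metis
  then show ?thesis
    using Supp_subset_set[of "xs @ ys"] Supp_reduced_word[of xs] Supp_reduced_word[of ys] by simp
qed

lemma Supp_mono: "x \<preceq> y \<Longrightarrow> Supp x \<subseteq> Supp y"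
  using bruhat_le_trans by (auto simp: Supp_def)

lemma Supp_inv [simp]:
  assumes "x \<in> carrier W"
  shows "Supp (inv x) = Supp x"
proof -
  have "Supp (inv y) \<subseteq> Supp y" if "y \<in> carrier W" for y
  proof -
    obtain ys where ys: "ys \<in> lists S" "length ys = len y" "word_prod W ys = y"
      using \<open>y \<in> carrier W\<close> reduced_word by metis
    then show ?thesis
      using Supp_subset_set[of "rev ys"] Supp_reduced_word[of ys] inv_word_prod[of ys]
      by (simp add: in_lists_conv_set)
  qed
  from this[of x] this[of "inv x"] assms show ?thesis by auto
qed

lemma Supp_gen [simp]: "s \<in> S \<Longrightarrow> Supp s = {s}"
  using Supp_reduced_word[of "[s]"] by simp

lemma Supp_one [simp]: "Supp \<one> = {}"
  using Supp_reduced_word[of "[]"] by simp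

lemma Supp_empty_iff: "x \<in> carrier W \<Longrightarrow> Supp x = {} \<longleftrightarrow> x = \<one>"
  using Supp_reduced_word reduced_word[of x] by (metis Supp_one set_empty word_prod_Nil)

lemma le_mult_if_len_add: 
  assumes "x \<in> carrier W" "y \<in> carrier W" "len (x \<otimes> y) = len x + len y"
  shows "x \<preceq> x \<otimes> y" "y \<preceq> x \<otimes> y"
proof -
  obtain xs ys where *: "xs \<in> lists S" "length xs = len x" "word_prod W xs = x"
    "ys \<in> lists S" "length ys = len y" "word_prod W ys = y"
    using assms reduced_word by metis
  moreover have "subseq xs (xs @ ys)" "subseq ys (xs @ ys)" by auto
  moreover have "xs @ ys \<in> lists S" "length (xs @ ys) = len (word_prod W (xs @ ys))"
    using * assms by auto
  ultimately show "x \<preceq> x \<otimes> y" "y \<preceq> x \<otimes> y"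
    using le_of_subword[of "xs @ ys"] by fastforce+
qed

lemma right_descent_Supp:
  assumes "x \<in> carrier W" "r \<in> S" "len (x \<otimes> r) < len x"
  shows "r \<in> Supp x"
proof -
  have "len (x \<otimes> r \<otimes> r) = len (x \<otimes> r) + len r"
    using len_mult_gen_cases[OF assms(1,2)] assms by auto
  then have "r \<preceq> x" using le_mult_if_len_add(2)[of "x \<otimes> r" r] assms by simp
  then show ?thesis using assms by (simp add: Supp_def)
qed

text \<open>Exchange erases a letter in the concatenation of reduced words of \<open>x\<close> and
  \<open>y\<close>. Erasing it in the part of \<open>y\<close> would make \<open>r\<close> a right
  descent of \<open>y\<close>, so the letter comes from \<open>x\<close>.\<close>

lemma exchange_mult:
  assumes x: "x \<in> carrier W" and y: "y \<in> carrier W" and r: "r \<in> S"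
    and less: "len (x \<otimes> y \<otimes> r) < len (x \<otimes> y)" and ndesc: "\<not> len (y \<otimes> r) < len y"
  obtains x' where "x' \<preceq> x" "len x' < len x" "x \<otimes> y \<otimes> r = x' \<otimes> y"
proof -
  obtain xs ys where *: "xs \<in> lists S" "length xs = len x" "word_prod W xs = x"
    "ys \<in> lists S" "length ys = len y" "word_prod W ys = y"
    using x y reduced_word by metis
  then obtain us a vs where del: "xs @ ys = us @ a # vs" "x \<otimes> y \<otimes> r = word_prod W (us @ vs)"
    using exchange_right[of "xs @ ys" r] gen_reflection[OF r] less by auto
  from del(1) consider (left) vs' where "xs = us @ a # vs'" "vs = vs' @ ys"
    | (right) us' where "ys = us' @ a # vs" "us = xs @ us'"
    by (auto simp: append_eq_append_conv2 Cons_eq_append_conv append_eq_Cons_conv)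
  then show thesis
  proof cases
    case left
    let ?x' = "word_prod W (us @ vs')"
    have "subseq (us @ vs') xs" unfolding left by (rule subseq_delete)
    then have "?x' \<preceq> x" using le_of_subword[of xs] * by simp
    moreover have S: "us @ vs' \<in> lists S" using * left by auto
    then have "len ?x' \<le> length (us @ vs')" using len_word_le by blast
    then have "len ?x' < len x" using * left by simp
    moreover have "x \<otimes> y \<otimes> r = ?x' \<otimes> y"
      using del left * S y by (simp add: m_assoc)
    ultimately show thesis using that by blast
  next
    case right
    have S: "us' @ vs \<in> lists S" using * right by auto
    then have "x \<otimes> (y \<otimes> r) = x \<otimes> word_prod W (us' @ vs)"
      using del right * x y r by (simp add: m_assoc)
    then have "y \<otimes> r = word_prod W (us' @ vs)"
      using x y r S by simp
    then have "len (y \<otimes> r) \<le> length (us' @ vs)" using S len_word_le by metis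
    then show thesis using ndesc * right by simp
  qed
qed

lemma parabolic_one [simp]: "\<one> \<in> parabolic J"
  by (simp add: parabolic_def generate.one)

lemma parabolic_gen: "r \<in> J \<Longrightarrow> r \<in> parabolic J"
  by (simp add: parabolic_def generate.incl)

lemma parabolic_mult: "\<lbrakk>x \<in> parabolic J; y \<in> parabolic J\<rbrakk> \<Longrightarrow> x \<otimes> y \<in> parabolic J"
  by (simp add: parabolic_def generate.eng)

lemma parabolic_inv: "\<lbrakk>J \<subseteq> S; x \<in> parabolic J\<rbrakk> \<Longrightarrow> inv x \<in> parabolic J"
  by (simp add: parabolic_iff)

lemma parabolic_closed: "\<lbrakk>J \<subseteq> S; x \<in> parabolic J\<rbrakk> \<Longrightarrow> x \<in> carrier W"
  by (simp add: parabolic_iff)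

subsection \<open>Minimal coset representatives\<close>

lemma quot_R_iff:
  assumes "J \<subseteq> S"
  shows "x \<in> quot_R J \<longleftrightarrow> x \<in> carrier W \<and> (\<forall>r\<in>J. len (x \<otimes> r) = Suc (len x))"
proof -
  have "len (x \<otimes> r) = Suc (len x) \<longleftrightarrow> \<not> len (x \<otimes> r) < len x" if "x \<in> carrier W" "r \<in> J" for r
    using len_mult_gen_cases[of x r] that assms by auto
  then show ?thesis
    using assms unfolding quot_R_def D_R_def by blast
qed

text \<open>Build \<open>y\<close> up letter by letter. If appending \<open>r\<close> to
  \<open>x \<otimes> z\<close> shortened it, exchange would replace \<open>x\<close> by a shorter
  element of the same coset, against minimality.\<close>

lemma len_mult_of_coset_min:
  assumes J: "J \<subseteq> S" and x: "x \<in> carrier W"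
    and min: "\<And>y. y \<in> parabolic J \<Longrightarrow> len x \<le> len (x \<otimes> y)"
    and "y \<in> parabolic J"
  shows "len (x \<otimes> y) = len x + len y"
  using assms(4)
proof (induction "len y" arbitrary: y rule: less_induct)
  case less
  then have y: "y \<in> carrier W" using parabolic_closed J by blast
  show ?case
  proof (cases "y = \<one>")
    case False
    with y obtain r where r: "r \<in> S" "len y = Suc (len (y \<otimes> r))"
      using exists_right_descent by blast
    then have "r \<in> J"
      using right_descent_Supp[OF y r(1)] less.prems J by (auto simp: parabolic_iff)
    let ?z = "y \<otimes> r"
    have z: "?z \<in> parabolic J" using \<open>r \<in> J\<close> less.prems parabolic_mult parabolic_gen by blast
    then have zc: "?z \<in> carrier W" using parabolic_closed J by blast
    have IH: "len (x \<otimes> ?z) = len x + len ?z" using less.hyps[OF _ z] r by simp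
    have zr: "?z \<otimes> r = y" using y r by simp
    have xzr: "x \<otimes> ?z \<otimes> r = x \<otimes> y" using x y r by (simp add: m_assoc)
    have "\<not> len (x \<otimes> y) < len (x \<otimes> ?z)"
    proof
      assume "len (x \<otimes> y) < len (x \<otimes> ?z)"
      then obtain x' where x': "x' \<preceq> x" "len x' < len x" "x \<otimes> ?z \<otimes> r = x' \<otimes> ?z"
        using exchange_mult[OF x zc r(1)] xzr zr r(2) by auto
      then have x'c: "x' \<in> carrier W" using bruhat_le_carrier by blast
      have "x' = x \<otimes> y \<otimes> inv ?z"
        using x'(3) xzr x y zc x'c by (simp add: inv_solve_right)
      then have "x' = x \<otimes> (y \<otimes> inv ?z)"
        using x y zc inv_closed m_assoc by simp
      moreover have "y \<otimes> inv ?z \<in> parabolic J"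
        using less.prems z parabolic_mult parabolic_inv J by blast
      ultimately show False using min x'(2) by fastforce
    qed
    then have "len (x \<otimes> y) = Suc (len (x \<otimes> ?z))"
      using len_mult_gen_cases[of "x \<otimes> ?z" r] x zc r xzr by auto
    then show ?thesis using IH r by simp
  qed (use x in simp)
qed

lemma coset_min:
  assumes J: "J \<subseteq> S" and u: "u \<in> carrier W"
  obtains y where "y \<in> parabolic J" "\<And>z. z \<in> parabolic J \<Longrightarrow> len (u \<otimes> y \<otimes> z) = len (u \<otimes> y) + len z"
proof -
  obtain y where y: "y \<in> parabolic J" "\<And>z. z \<in> parabolic J \<Longrightarrow> len (u \<otimes> y) \<le> len (u \<otimes> z)"
    using ex_has_least_nat[of "\<lambda>y. y \<in> parabolic J" \<one> "\<lambda>y. len (u \<otimes> y)"] parabolic_one by blast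
  then have yc: "y \<in> carrier W" using parabolic_closed J by blast
  have "len (u \<otimes> y) \<le> len (u \<otimes> y \<otimes> z)" if "z \<in> parabolic J" for z
    using y that parabolic_mult parabolic_closed[OF J] u yc by (simp add: m_assoc)
  then show thesis
    using that[OF y(1)] len_mult_of_coset_min[OF J, of "u \<otimes> y"] u yc by blast
qed

text \<open>Membership in \<open>quot_R J\<close> speaks of single letters only. To obtain
  minimality in the coset, compare \<open>x\<close> with a minimum \<open>x \<otimes> z\<close>: a
  right descent of \<open>inv z\<close> would be a right descent of \<open>x\<close> in
  \<open>J\<close>, so \<open>z = \<one>\<close>.\<close>

lemma len_quot_R_mult:
  assumes J: "J \<subseteq> S" and x: "x \<in> quot_R J" and "y \<in> parabolic J"
  shows "len (x \<otimes> y) = len x + len y"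
proof -
  have xc: "x \<in> carrier W" using x by (simp add: quot_R_def)
  obtain z where z: "z \<in> parabolic J"
    and add: "\<And>y. y \<in> parabolic J \<Longrightarrow> len (x \<otimes> z \<otimes> y) = len (x \<otimes> z) + len y"
    using coset_min[OF J xc] by blast
  have zc: "z \<in> carrier W" using z parabolic_closed J by blast
  have "z = \<one>"
  proof (rule ccontr)
    assume "z \<noteq> \<one>"
    then have "inv z \<noteq> \<one>" using zc by (metis inv_inv inv_one)
    then obtain r where r: "r \<in> S" "len (inv z) = Suc (len (inv z \<otimes> r))"
      using exists_right_descent[of "inv z"] zc by auto
    then have "r \<in> J"
      using right_descent_Supp[of "inv z" r] z zc J by (auto simp: parabolic_iff)
    have "len x = len (x \<otimes> z) + len (inv z)"
      using add[of "inv z"] z parabolic_inv[OF J] xc zc by (simp add: m_assoc)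
    moreover have "inv z \<otimes> r \<in> parabolic J"
      using parabolic_mult parabolic_inv[OF J z] parabolic_gen[OF \<open>r \<in> J\<close>] by blast
    then have "len (x \<otimes> r) = len (x \<otimes> z) + len (inv z \<otimes> r)"
      using add[of "inv z \<otimes> r"] xc zc r by (simp add: m_assoc)
    ultimately show False
      using x r \<open>r \<in> J\<close> by (simp add: quot_R_iff[OF J])
  qed
  then show ?thesis using add assms xc by simp
qed

lemma quot_R_decomp:
  assumes J: "J \<subseteq> S" and u: "u \<in> carrier W"
  obtains x y where "x \<in> quot_R J" "y \<in> parabolic J" "u = x \<otimes> y"
proof -
  obtain z where z: "z \<in> parabolic J"
    and add: "\<And>y. y \<in> parabolic J \<Longrightarrow> len (u \<otimes> z \<otimes> y) = len (u \<otimes> z) + len y"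
    using coset_min[OF J u] by blast
  have zc: "z \<in> carrier W" using z parabolic_closed J by blast
  have "u \<otimes> z \<in> quot_R J"
    using add[OF parabolic_gen] u zc J by (auto simp: quot_R_iff[OF J])
  moreover have "inv z \<in> parabolic J" using z parabolic_inv J by blast
  moreover have "u = u \<otimes> z \<otimes> inv z" using u zc by (simp add: m_assoc)
  ultimately show thesis using that by blast
qed

lemma quot_R_unique:
  assumes J: "J \<subseteq> S" and "x \<in> quot_R J" "x' \<in> quot_R J" "y \<in> parabolic J" "y' \<in> parabolic J"
    and eq: "x \<otimes> y = x' \<otimes> y'"
  shows "x = x' \<and> y = y'"
proof -
  have c: "x \<in> carrier W" "x' \<in> carrier W" "y \<in> carrier W" "y' \<in> carrier W"
    using assms parabolic_closed[OF J] by (auto simp: quot_R_def)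
  let ?z = "y' \<otimes> inv y"
  have z: "?z \<in> parabolic J" using assms parabolic_mult parabolic_inv by blast
  have x: "x = x' \<otimes> ?z"
    using c eq by (simp add: inv_solve_right flip: m_assoc)
  then have x': "x' = x \<otimes> inv ?z"
    using c by (simp add: m_assoc inv_mult_group)
  have "len x = len x' + len ?z"
    using len_quot_R_mult[OF J assms(3) z] x by simp
  moreover have "len x' = len x + len (inv ?z)"
    using len_quot_R_mult[OF J assms(2) parabolic_inv[OF J z]] x' by simp
  ultimately have "?z = \<one>" using c by simp
  then show ?thesis using x c inv_solve_right'[of \<one> y' y] by auto
qed

lemma min_R_par_R_eq:
  assumes J: "J \<subseteq> S" and x: "x \<in> quot_R J" and y: "y \<in> parabolic J"
  shows "min_R J (x \<otimes> y) = x" "par_R J (x \<otimes> y) = y"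
  unfolding min_R_def par_R_def using assms quot_R_unique[OF J] by (blast intro!: the_equality)+

end

subsection \<open>The opposite Coxeter system\<close>

text \<open>Reversing the product preserves length, reflections, Bruhat order, supports, parabolic
  subgroups and matchings, and exchanges left with right cosets. Statements about right cosets are
  thereby available on the left.\<close>

definition opp :: "('a, 'b) monoid_scheme \<Rightarrow> ('a, 'b) monoid_scheme" where
  "opp G = G\<lparr>mult := \<lambda>x y. y \<otimes>\<^bsub>G\<^esub> x\<rparr>"

lemma opp_simps [simp]:
  "carrier (opp G) = carrier G" "x \<otimes>\<^bsub>opp G\<^esub> y = y \<otimes>\<^bsub>G\<^esub> x" "\<one>\<^bsub>opp G\<^esub> = \<one>\<^bsub>G\<^esub>"
  by (simp_all add: opp_def)

lemma opp_opp [simp]: "opp (opp G) = G"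
  by (simp add: opp_def)

lemma opp_inv [simp]: "inv\<^bsub>opp G\<^esub> x = inv\<^bsub>G\<^esub> x"
  unfolding m_inv_def opp_simps by (rule arg_cong[of _ _ The]) auto

lemma opp_group: "group G \<Longrightarrow> group (opp G)"
proof (rule groupI)
  assume "group G"
  then interpret group G .
  show "\<exists>y\<in>carrier (opp G). y \<otimes>\<^bsub>opp G\<^esub> x = \<one>\<^bsub>opp G\<^esub>" if "x \<in> carrier (opp G)" for x
    using that by (intro bexI[of _ "inv\<^bsub>G\<^esub> x"]) auto
qed (auto dest: group.is_monoid simp: monoid.m_closed monoid.m_assoc monoid.one_closed monoid.r_one)

lemma opp_generate [simp]: "generate (opp G) H = generate G H"
proof -
  have "x \<in> generate (opp G) H" if "x \<in> generate G H" for x and G :: "('a, 'b) monoid_scheme"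
    using that
  proof induction
    case (inv h)
    then show ?case using generate.inv[of h H "opp G"] by simp
  next
    case (eng h1 h2)
    then show ?case using generate.eng[of h2 "opp G" H h1] by simp
  qed (use generate.one[of "opp G"] generate.incl in auto)
  from this[of _ G] this[of _ "opp G"] show ?thesis by auto
qed

context coxeter_system
begin

lemma word_prod_opp: "xs \<in> lists S \<Longrightarrow> word_prod (opp W) xs = word_prod W (rev xs)"
  by (induction xs) (auto simp: word_prod_def[of "opp W"] in_lists_conv_set)

text \<open>A relator in \<open>s\<close>, \<open>t\<close> read backwards is the relator in
  \<open>t\<close>, \<open>s\<close>; the exponents agree because the Coxeter matrix is
  symmetric.\<close>

lemma coxeter_deletion_rev:
  assumes "coxeter_matrix S m" "coxeter_deletion S m xs ys"
  shows "coxeter_deletion S m (rev xs) (rev ys)"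
  using assms(2)
proof cases
  case (1 us vs s t)
  have "rev (concat (replicate n [s, t])) = concat (replicate n [t, s])" for n
  proof (induction n)
    case (Suc n)
    have "concat (replicate n [t, s]) @ [t, s] = [t, s] @ concat (replicate n [t, s])" for n
      by (induction n) auto
    with Suc show ?case by simp
  qed simp
  moreover have "m s t = m t s" using assms(1) 1 by (auto simp: coxeter_matrix_def)
  moreover have "rev us \<in> lists S" "rev vs \<in> lists S" using 1 by (auto simp: in_lists_conv_set)
  ultimately show ?thesis
    using 1 coxeter_deletion.intros[of "rev vs" S "rev us" t s m] by simp
qed

lemma coxeter_system_opp: "coxeter_system (opp W) S"
proof -
  obtain m where m: "coxeter_matrix S m" "\<forall>xs\<in>lists S. \<forall>ys\<in>lists S.
         word_prod W xs = word_prod W ys \<longleftrightarrow> equivclp (coxeter_deletion S m) xs ys"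
    using presentation by blast
  have rev: "equivclp (coxeter_deletion S m) (rev xs) (rev ys)"
    if "equivclp (coxeter_deletion S m) xs ys" for xs ys
    using that
  proof (induction rule: equivclp_induct)
    case (step y z)
    then have "equivclp (coxeter_deletion S m) (rev y) (rev z)"
      using coxeter_deletion_rev[OF m(1)] by (meson equivclp_sym r_into_equivclp)
    with step show ?case by (meson equivclp_trans)
  qed simp
  have "word_prod (opp W) xs = word_prod (opp W) ys \<longleftrightarrow> equivclp (coxeter_deletion S m) xs ys"
    if "xs \<in> lists S" "ys \<in> lists S" for xs ys
  proof -
    have "rev xs \<in> lists S" "rev ys \<in> lists S" using that by (auto simp: in_lists_conv_set)
    then show ?thesis
      using m(2) that rev[of xs ys] rev[of "rev xs" "rev ys"] by (auto simp: word_prod_opp)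
  qed
  then show ?thesis
    using opp_group[OF is_group] gens_closed gens_generate m(1)
    by (auto simp: coxeter_system_def coxeter_system_axioms_def)
qed

interpretation op: coxeter_system "opp W" S
  by (rule coxeter_system_opp)

lemma opp_len [simp]: "op.len = len"
proof
  fix u
  have "(\<exists>xs\<in>lists S. length xs = n \<and> word_prod (opp W) xs = u) \<longleftrightarrow>
     (\<exists>xs\<in>lists S. length xs = n \<and> word_prod W xs = u)" for n
  proof -
    have rev: "rev xs \<in> lists S" if "xs \<in> lists S" for xs
      using that by (simp add: in_lists_conv_set)
    show ?thesis
      using rev word_prod_opp by (metis length_rev rev_rev_ident)
  qed
  then show "op.len u = len u" by (simp add: op.len_def len_def)
qed

lemma opp_reflections [simp]: "op.reflections = reflections"
proof -
  have "(\<exists>g s. t = inv g \<otimes> (s \<otimes> g) \<and> g \<in> carrier W \<and> s \<in> S) \<longleftrightarrow>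
    (\<exists>g s. t = g \<otimes> s \<otimes> inv g \<and> g \<in> carrier W \<and> s \<in> S)" for t
    by (metis gen_closed inv_closed inv_inv m_assoc)
  then show ?thesis by (auto simp: op.reflections_def reflections_def)
qed

text \<open>Reflections are closed under conjugation, so left and right multiplication by
  reflections relate the same pairs.\<close>

lemma opp_bruhat_step [simp]: "op.bruhat_step = bruhat_step"
proof (intro ext)
  fix x y
  have "(\<exists>t\<in>reflections. y = t \<otimes> x) \<longleftrightarrow> (\<exists>t\<in>reflections. y = x \<otimes> t)" if x: "x \<in> carrier W"
  proof
    assume "\<exists>t\<in>reflections. y = t \<otimes> x"
    then obtain t where t: "t \<in> reflections" "y = t \<otimes> x" by blast
    then have "inv x \<otimes> t \<otimes> inv (inv x) \<in> reflections" using reflection_conj x by blast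
    moreover have "y = x \<otimes> (inv x \<otimes> t \<otimes> inv (inv x))"
      using t x reflections_closed by (simp add: m_assoc)
    ultimately show "\<exists>t\<in>reflections. y = x \<otimes> t" by blast
  next
    assume "\<exists>t\<in>reflections. y = x \<otimes> t"
    then obtain t where t: "t \<in> reflections" "y = x \<otimes> t" by blast
    then have "x \<otimes> t \<otimes> inv x \<in> reflections" using reflection_conj x by blast
    moreover have "y = (x \<otimes> t \<otimes> inv x) \<otimes> x"
      using t x reflections_closed by (simp add: m_assoc)
    ultimately show "\<exists>t\<in>reflections. y = t \<otimes> x" by blast
  qed
  then show "op.bruhat_step x y = bruhat_step x y"
    by (auto simp: op.bruhat_step_def bruhat_step_def)
qed

lemma opp_bruhat_le [simp]: "op.bruhat_le = bruhat_le"
  by (intro ext) (simp add: op.bruhat_le_def bruhat_le_def)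

lemma opp_lower [simp]: "op.lower = lower"
  by (intro ext) (simp add: op.lower_def lower_def)

lemma opp_covered_in [simp]: "op.covered_in = covered_in"
  by (intro ext) (simp add: op.covered_in_def covered_in_def)

lemma opp_parabolic [simp]: "op.parabolic = parabolic"
  by (intro ext) (simp add: op.parabolic_def parabolic_def)

lemma opp_Supp [simp]: "op.Supp = Supp"
  by (intro ext) (simp add: op.Supp_def Supp_def)

lemma opp_matching [simp]: "op.matching = matching"
  by (intro ext) (simp add: op.matching_def matching_def)

lemma opp_commuting_gens [simp]: "op.commuting_gens = commuting_gens"
  by (intro ext) (auto simp: op.commuting_gens_def commuting_gens_def)

lemma opp_quot [simp]: "op.quot_R = quot_L" "op.quot_L = quot_R"
  by (intro ext; simp add: op.quot_R_def quot_L_def op.quot_L_def quot_R_def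
      op.D_R_def D_L_def op.D_L_def D_R_def)+

lemma opp_coset [simp]:
  "op.min_R = min_L" "op.par_R = par_L" "op.min_L = min_R" "op.par_L = par_R"
  by (intro ext; simp add: op.min_R_def op.par_R_def op.min_L_def op.par_L_def
      min_R_def par_R_def min_L_def par_L_def)+

lemma quot_L_iff:
  "J \<subseteq> S \<Longrightarrow> x \<in> quot_L J \<longleftrightarrow> x \<in> carrier W \<and> (\<forall>r\<in>J. len (r \<otimes> x) = Suc (len x))"
  using op.quot_R_iff by simp

lemma len_gen_mult_cases:
  "\<lbrakk>x \<in> carrier W; s \<in> S\<rbrakk> \<Longrightarrow> len (s \<otimes> x) = Suc (len x) \<or> len x = Suc (len (s \<otimes> x))"
  using op.len_mult_gen_cases by simp

lemma left_descent_Supp: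
  "\<lbrakk>x \<in> carrier W; r \<in> S; len (r \<otimes> x) < len x\<rbrakk> \<Longrightarrow> r \<in> Supp x"
  using op.right_descent_Supp by simp

lemma exchange_mult_left:
  assumes "x \<in> carrier W" "y \<in> carrier W" "r \<in> S"
    "len (r \<otimes> (x \<otimes> y)) < len (x \<otimes> y)" "\<not> len (r \<otimes> x) < len x"
  obtains y' where "y' \<preceq> y" "len y' < len y" "r \<otimes> (x \<otimes> y) = x \<otimes> y'"
  using op.exchange_mult[of y x r] assms by auto

lemma len_quot_L_mult:
  "\<lbrakk>J \<subseteq> S; x \<in> quot_L J; y \<in> parabolic J\<rbrakk> \<Longrightarrow> len (y \<otimes> x) = len x + len y"
  using op.len_quot_R_mult by simp

lemma quot_L_decomp:
  assumes "J \<subseteq> S" "u \<in> carrier W"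
  obtains x y where "x \<in> quot_L J" "y \<in> parabolic J" "u = y \<otimes> x"
  using op.quot_R_decomp[of J u] assms by auto

lemma min_L_par_L_eq:
  "\<lbrakk>J \<subseteq> S; x \<in> quot_L J; y \<in> parabolic J\<rbrakk> \<Longrightarrow> min_L J (y \<otimes> x) = x"
  "\<lbrakk>J \<subseteq> S; x \<in> quot_L J; y \<in> parabolic J\<rbrakk> \<Longrightarrow> par_L J (y \<otimes> x) = y"
  using op.min_R_par_R_eq by simp_all

end

section \<open>Letters commuting with elements of a parabolic subgroup\<close>

context coxeter_system
begin

lemma finite_Supp: "x \<in> carrier W \<Longrightarrow> finite (Supp x)"
  using Supp_reduced_word reduced_word[of x] by (metis List.finite_set)

lemma len_mult_gen_outside:
  assumes "H \<subseteq> S" "x \<in> parabolic H" "p \<in> S" "p \<notin> H"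
  shows "len (x \<otimes> p) = Suc (len x)"
  using assms right_descent_Supp[of x p] len_mult_gen_cases[of x p] by (auto simp: parabolic_iff)

lemma mult_gen_eq_one:
  assumes "x \<in> carrier W" "r \<in> S" "x \<otimes> r = \<one>"
  shows "x = r"
proof -
  have "x = x \<otimes> r \<otimes> r" using assms(1,2) by simp
  then show ?thesis using assms(2) by (simp add: assms(3))
qed

lemma parabolic_singleton:
  assumes r: "r \<in> S" and x: "x \<in> carrier W" "Supp x \<subseteq> {r}"
  shows "x = \<one> \<or> x = r"
proof (rule ccontr)
  assume *: "\<not> (x = \<one> \<or> x = r)"
  then obtain t where t: "t \<in> S" "len x = Suc (len (x \<otimes> t))"
    using exists_right_descent x by blast
  then have "t = r" using right_descent_Supp[of x t] x by auto
  have "x \<otimes> r \<noteq> \<one>" using mult_gen_eq_one[OF x(1) r] * by blast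
  then obtain t' where t': "t' \<in> S" "len (x \<otimes> r) = Suc (len (x \<otimes> r \<otimes> t'))"
    using exists_right_descent[of "x \<otimes> r"] x r by auto
  moreover have "Supp (x \<otimes> r) \<subseteq> {r}" using Supp_mult[of x r] x r by auto
  ultimately have "t' = r" using right_descent_Supp[of "x \<otimes> r" t'] x r by auto
  then show False using t t' \<open>t = r\<close> x r by simp
qed

text \<open>Since \<open>x p r = p (x r)\<close> is shorter than \<open>x p\<close>, exchange gives
  \<open>x p r = x' p\<close>, so \<open>p r = h p\<close> with \<open>h\<close> in
  \<open>W_H\<close>. As \<open>p\<close> lies outside \<open>H\<close>, lengths force
  \<open>h\<close> to be a letter; it belongs to \<open>H\<close> and to the support of
  \<open>p r\<close>, hence it is \<open>r\<close>.\<close>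

lemma commute_with_right_descent:
  assumes H: "H \<subseteq> S" and x: "x \<in> parabolic H" and p: "p \<in> S" "p \<notin> H"
    and comm: "p \<otimes> x = x \<otimes> p" and r: "r \<in> S" "len (x \<otimes> r) < len x"
  shows "p \<otimes> r = r \<otimes> p"
proof -
  have xc: "x \<in> carrier W" "Supp x \<subseteq> H" using x H by (auto simp: parabolic_iff)
  have rH: "r \<in> H" using right_descent_Supp[OF xc(1) r] xc by blast
  have len_pr: "len (p \<otimes> r) = 2"
    using len_gen_mult_cases[of r p] r p rH H left_descent_Supp[of r p] by auto
  have "x \<otimes> p \<otimes> r = p \<otimes> (x \<otimes> r)"
    using comm xc p r by (simp flip: m_assoc comm)
  then have "len (x \<otimes> p \<otimes> r) < Suc (len x)"
    using len_mult_le[of p "x \<otimes> r"] xc p r by simp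
  then have "len (x \<otimes> p \<otimes> r) < len (x \<otimes> p)"
    using len_mult_gen_outside[OF H x p] len_mult_gen_cases[of "x \<otimes> p" r] xc p r by auto
  then obtain x' where x': "x' \<preceq> x" "x \<otimes> p \<otimes> r = x' \<otimes> p"
    using exchange_mult[of x p r] xc p r len_pr by auto
  then have x'H: "x' \<in> carrier W" "x' \<in> parabolic H"
    using bruhat_le_carrier Supp_mono[OF x'(1)] xc H by (auto simp: parabolic_iff)
  let ?h = "inv x \<otimes> x'"
  have h: "?h \<in> parabolic H" using x'H x parabolic_mult parabolic_inv H by blast
  then have hc: "?h \<in> carrier W" "Supp ?h \<subseteq> H" using H by (auto simp: parabolic_iff)
  have pr: "p \<otimes> r = ?h \<otimes> p"
  proof -
    have "inv x \<otimes> (x \<otimes> p \<otimes> r) = p \<otimes> r" using xc p r by (simp add: m_assoc)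
    then show ?thesis using x' xc x'H p by (simp add: m_assoc)
  qed
  have len_hp: "len (?h \<otimes> p) = Suc (len ?h)"
    using len_mult_gen_outside[OF H h p] .
  then have "len ?h = 1" using len_pr pr by simp
  then have hS: "?h \<in> S" using len_eq_1_iff hc by blast
  then have "?h \<in> H" using hc by simp
  have "?h \<preceq> ?h \<otimes> p" using le_mult_if_len_add(1)[of ?h p] hc p len_hp by simp
  then have "?h \<in> Supp (p \<otimes> r)" using hS pr by (simp add: Supp_def)
  then have "?h \<in> {p, r}" using Supp_mult[of p r] p r by auto
  then have "?h = r" using \<open>?h \<in> H\<close> p by blast
  then show ?thesis using pr by simp
qed

end

subsection \<open>Matchings of the first kind\<close>

text \<open>Here \<open>s\<close> stands for \<open>M(e)\<close> and \<open>v\<close> for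
  \<open>w_0(H)\<close>. The assumption \<open>H_Int_comm\<close> is the form in which S0 enters,
  and \<open>H_other\<close> expresses that \<open>H\<close> has at most one letter besides
  \<open>s\<close>. \<open>K\<close> is a parameter of its own rather than the complement of
  \<open>J\<close>, so that \<open>J\<close> and \<open>K\<close> can trade places in the opposite
  group.\<close>

locale first_kind_matching = coxeter_system W S for W (structure) and S :: "'a set" +
  fixes J K H :: "'a set" and s v :: 'a and M :: "'a \<Rightarrow> 'a"
  assumes J_sub: "J \<subseteq> S" and K_sub: "K \<subseteq> S" and H_sub_K: "H \<subseteq> K"
    and J_Int_K: "J \<inter> K = commuting_gens s"
    and H_Int_comm: "H \<inter> commuting_gens s = {s}"
    and H_other: "\<lbrakk>r \<in> H; r' \<in> H; r \<noteq> s; r' \<noteq> s\<rbrakk> \<Longrightarrow> r = r'"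
    and v_par: "v \<in> parabolic H"
    and matching_M: "matching (lower v) M"
    and M_one: "M \<one> = s"
begin

lemma H_sub: "H \<subseteq> S"
  using H_sub_K K_sub by blast

lemma s_mem: "s \<in> S" "s \<in> H" "s \<in> J"
  using H_Int_comm J_Int_K H_sub by blast+

lemma comm_mem:
  assumes "p \<in> commuting_gens s"
  shows "p \<in> S" "p \<in> J" "p \<in> K" "s \<otimes> p = p \<otimes> s" "p \<noteq> s \<Longrightarrow> p \<notin> H"
  using assms J_Int_K H_Int_comm by (auto simp: commuting_gens_def)

lemma v_closed: "v \<in> carrier W"
  using v_par H_sub parabolic_closed by blast

lemma lower_v: 
  assumes "x \<in> lower v"
  shows "x \<in> carrier W" "x \<in> parabolic H"
  using assms v_par Supp_mono by (auto simp: lower_def parabolic_iff[OF H_sub])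

lemma M_lower:
  assumes "x \<in> lower v"
  shows "M x \<in> lower v" "M (M x) = x" "x \<lhd>\<^sub>B M x \<or> M x \<lhd>\<^sub>B x"
  using assms matching_M by (auto simp: matching_def covered_in_lower_iff)

lemma one_lower: "\<one> \<in> lower v"
  using v_closed by (simp add: lower_def)

lemma s_lower: "s \<in> lower v" and M_s: "M s = \<one>"
  using M_lower[OF one_lower] M_one by simp_all

text \<open>The element \<open>b p b\<^sup>-\<^sup>1 = a\<^sup>-\<^sup>1 a'\<close> is supported on \<open>p\<close> and the at most one
  letter of \<open>H\<close> in \<open>a\<close>.\<close>

lemma commutation_cases:
  assumes a: "a \<in> carrier W" "card (Supp a \<inter> H) \<le> 1"
    and b: "b \<in> parabolic H" "b \<in> quot_R {s}"
    and p: "p \<in> commuting_gens s" "p \<noteq> s"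
    and a': "a' \<in> carrier W" "Supp a' \<subseteq> Supp a" and eq: "a \<otimes> b \<otimes> p = a' \<otimes> b"
  shows "(\<forall>r\<in>H. p \<otimes> r = r \<otimes> p) \<or> b = \<one> \<or> (b \<in> Supp a \<inter> H \<and> b \<noteq> s)"
proof -
  have pS: "p \<in> S" "p \<notin> H" "p \<in> carrier W" using comm_mem[OF p(1)] p(2) by auto
  have bc: "b \<in> carrier W" "Supp b \<subseteq> H" using b H_sub by (auto simp: parabolic_iff)
  let ?A = "Supp a \<inter> H"
  let ?D = "insert p ?A"
  have D: "?D \<subseteq> S" using pS Supp_subset_S by auto
  let ?f = "inv a \<otimes> a'"
  have f: "?f = b \<otimes> p \<otimes> inv b"
  proof -
    have "?f \<otimes> b = inv a \<otimes> (a \<otimes> b \<otimes> p)" using a a' bc eq by (simp add: m_assoc)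
    also have "\<dots> = b \<otimes> p" using a bc pS by (simp add: m_assoc)
    finally show ?thesis using a a' bc pS by (simp add: inv_solve_right)
  qed
  have "Supp ?f \<subseteq> Supp a" using Supp_mult[of "inv a" a'] a a' by auto
  moreover have "Supp ?f \<subseteq> insert p H"
    unfolding f using Supp_mult[of "b \<otimes> p" "inv b"] Supp_mult[of b p] bc pS by auto
  ultimately have fD: "?f \<in> parabolic ?D"
    using a a' parabolic_iff[OF D] by auto
  \<comment> \<open>Splitting off the part of \<open>b\<close> in the parabolic subgroup of
    \<open>?D\<close> makes the remaining conjugation visible in lengths:
    \<open>?q \<otimes> x = x \<otimes> p\<close> with \<open>x\<close> minimal on the left forces
    \<open>?q\<close> to have length one.\<close>
  obtain x g where x: "x \<in> quot_L ?D" and g: "g \<in> parabolic ?D" and bgx: "b = g \<otimes> x"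
    using quot_L_decomp[OF D bc(1)] by blast
  have xc: "x \<in> carrier W" "g \<in> carrier W"
    using x g parabolic_closed[OF D] by (auto simp: quot_L_def)
  have len_b: "len b = len g + len x" using len_quot_L_mult[OF D x g] bgx by simp
  then have "g \<preceq> b" "x \<preceq> b" using le_mult_if_len_add[of g x] xc bgx by auto
  then have Supp_gx: "Supp g \<subseteq> H" "Supp x \<subseteq> H" using Supp_mono bc by blast+
  then have xH: "x \<in> parabolic H" using xc H_sub by (simp add: parabolic_iff)
  have gA: "Supp g \<subseteq> ?A" using g Supp_gx pS by (auto simp: parabolic_iff[OF D])
  let ?q = "inv g \<otimes> ?f \<otimes> g"
  have q: "?q \<in> parabolic ?D" using fD g parabolic_mult parabolic_inv[OF D] by blast
  then have qc: "?q \<in> carrier W" "Supp ?q \<subseteq> ?D" using parabolic_iff[OF D] by auto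
  have qx: "?q \<otimes> x = x \<otimes> p"
  proof -
    have "?q \<otimes> x = inv g \<otimes> (?f \<otimes> b)" using xc bgx a a' by (simp add: m_assoc)
    also have "?f \<otimes> b = b \<otimes> p" unfolding f using bc pS by (simp add: m_assoc)
    finally show ?thesis using xc bgx pS by (simp add: m_assoc)
  qed
  have "len (x \<otimes> p) = Suc (len x)" using len_mult_gen_outside[OF H_sub xH pS(1,2)] .
  then have "len ?q = 1" using len_quot_L_mult[OF D x q] qx by simp
  then have qS: "?q \<in> S" using len_eq_1_iff qc by blast
  \<comment> \<open>A letter of \<open>H\<close> cannot be conjugate to \<open>p\<close> by the
    element \<open>x\<close> of \<open>W_H\<close>, because \<open>p\<close> lies outside
    \<open>W_H\<close>.\<close>
  have "?q = p"
  proof (rule ccontr)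
    assume "?q \<noteq> p"
    then have "?q \<in> H" using qc qS by simp
    then have "?q \<in> parabolic H" using parabolic_gen by blast
    then have "inv x \<otimes> (?q \<otimes> x) \<in> parabolic H"
      using xH parabolic_mult parabolic_inv[OF H_sub] by blast
    then have "p \<in> parabolic H" unfolding qx using xc pS by simp
    then show False using pS by (simp add: parabolic_iff[OF H_sub])
  qed
  then have comm: "p \<otimes> x = x \<otimes> p" using qx by simp
  show ?thesis
  proof (cases "x = \<one>")
    case True
    then have bA: "Supp b \<subseteq> ?A" using gA bgx xc by simp
    show ?thesis
    proof (cases "b = \<one>")
      case False
      then obtain r where r: "r \<in> S" "len b = Suc (len (b \<otimes> r))"
        using exists_right_descent bc by blast
      then have rA: "r \<in> ?A" using right_descent_Supp[of b r] bc bA by auto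
      have "r \<noteq> s" using r b s_mem by (auto simp: quot_R_iff)
      have "finite ?A" using finite_Supp a by blast
      then have "?A = {r}" using a(2) rA card_le_Suc0_iff_eq[of ?A] by auto
      then have "b = r" using parabolic_singleton[OF r(1) bc(1)] bA False by auto
      then show ?thesis using rA \<open>r \<noteq> s\<close> by blast
    qed simp
  next
    case False
    then obtain r where r: "r \<in> S" "len x = Suc (len (x \<otimes> r))"
      using exists_right_descent xc by blast
    then have "r \<in> H" using right_descent_Supp[of x r] xc Supp_gx by auto
    have pr: "p \<otimes> r = r \<otimes> p"
      using commute_with_right_descent[OF H_sub xH pS(1,2) comm r(1)] r by simp
    \<comment> \<open>A right descent of the right factor \<open>x\<close> is one of
      \<open>b\<close>, so \<open>r\<close> is not \<open>s\<close>; together \<open>r\<close> and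
      \<open>s\<close> exhaust \<open>H\<close>, and \<open>p\<close> commutes with both.\<close>
    have "len (b \<otimes> r) < len b"
      using len_mult_le[of g "x \<otimes> r"] xc r bgx len_b by (simp add: m_assoc)
    then have "r \<noteq> s" using b s_mem by (auto simp: quot_R_iff)
    then have "p \<otimes> r' = r' \<otimes> p" if "r' \<in> H" for r'
      using H_other[OF \<open>r \<in> H\<close> that] pr comm_mem(4)[OF p(1)] by (cases "r' = s") auto
    then show ?thesis by blast
  qed
qed

end

section \<open>Shifting letters into the right factor\<close>

context first_kind_matching
begin

text \<open>The form of a factorization that survives a shift. The condition
  \<open>b \<in> lower v\<close> keeps \<open>M b\<close> meaningful and contains
  \<open>b \<in> parabolic H\<close>, as \<open>v\<close> lies in \<open>W_H\<close>.\<close>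

definition adapted :: "'a \<Rightarrow> 'a \<Rightarrow> 'a \<Rightarrow> bool" where
  "adapted a b c \<longleftrightarrow>
     a \<in> parabolic K \<and> a \<in> quot_R H \<and> card (Supp a \<inter> H) \<le> 1 \<and>
     (\<forall>\<alpha>\<in>Supp a \<inter> H. \<forall>x\<in>lower v. M (\<alpha> \<otimes> x) = \<alpha> \<otimes> M x) \<and>
     b \<in> lower v \<and> c \<in> parabolic J \<and> c \<in> quot_L H \<and>
     len (a \<otimes> b \<otimes> c) = len a + len b + len c"

lemma adapted_closed:
  assumes "adapted a b c"
  shows "a \<in> carrier W" "b \<in> carrier W" "c \<in> carrier W" "b \<in> parabolic H" "M b \<in> carrier W"
    "M b \<in> parabolic H"
  using assms lower_v M_lower by (auto simp: adapted_def quot_R_def quot_L_def)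

text \<open>The factor \<open>q\<close> is the part of a middle factor that the canonical
  factorization assigns to \<open>u_J\<close>, because \<open>s\<close> belongs to both
  \<open>H\<close> and \<open>J\<close>.\<close>

lemma split_s:
  assumes "x \<in> parabolic H"
  obtains y q where "x = y \<otimes> q" "y \<in> quot_R {s}" "y \<in> parabolic H" "q = \<one> \<or> q = s"
    "len x = len y + len q"
proof -
  have sS: "{s} \<subseteq> S" using s_mem by blast
  have x: "x \<in> carrier W" using assms parabolic_closed H_sub by blast
  obtain y q where yq: "y \<in> quot_R {s}" "q \<in> parabolic {s}" "x = y \<otimes> q"
    using quot_R_decomp[OF sS x] by blast
  then have q: "q = \<one> \<or> q = s"
    using parabolic_singleton[of s q] s_mem by (auto simp: parabolic_iff[OF sS])
  have yc: "y \<in> carrier W" "q \<in> carrier W"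
    using yq q s_mem by (auto simp: quot_R_def)
  then have "y = x \<otimes> q" using yq q s_mem by auto
  moreover have "q \<in> parabolic H" using q s_mem parabolic_gen by auto
  ultimately have "y \<in> parabolic H" using assms parabolic_mult by blast
  then show thesis using that yq q len_quot_R_mult[OF sS yq(1,2)] by blast
qed

lemma M_q:
  assumes "q = \<one> \<or> q = s"
  shows "q \<in> lower v" "M q = q \<otimes> s" "q \<in> carrier W"
  using assms one_lower s_lower M_s M_one s_mem by auto

text \<open>On \<open>\<one>\<close> and \<open>s\<close> the matching is multiplication by
  \<open>s\<close>, and a letter \<open>y\<close> of \<open>a\<close> in \<open>H\<close> can be
  pulled out of \<open>M\<close> on the left.\<close>

lemma M_eq_mult_s:
  assumes ad: "adapted a b c" and y: "y = \<one> \<or> y \<in> Supp a \<inter> H" and q: "q = \<one> \<or> q = s"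
  shows "M (y \<otimes> q) = y \<otimes> q \<otimes> s"
proof -
  have "M (y \<otimes> q) = y \<otimes> M q"
    using y ad M_q[OF q] s_mem by (auto simp: adapted_def)
  moreover have "y \<in> carrier W" using y H_sub by auto
  ultimately show ?thesis using M_q[OF q] s_mem by (simp add: m_assoc)
qed

lemma commute_parabolic:
  assumes "p \<in> carrier W" "\<forall>r\<in>H. p \<otimes> r = r \<otimes> p" "x \<in> parabolic H"
  shows "p \<otimes> x = x \<otimes> p"
proof -
  have "x \<in> generate W H" using assms by (simp add: parabolic_def)
  then have "p \<otimes> x = x \<otimes> p \<and> x \<in> carrier W"
  proof induction
    case (inv h)
    moreover have "h \<in> S" using inv H_sub by blast
    ultimately show ?case using assms by auto
  next
    case (eng h1 h2)
    then have "p \<otimes> (h1 \<otimes> h2) = (h1 \<otimes> p) \<otimes> h2"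
      using assms(1) by (metis m_assoc)
    also have "\<dots> = (h1 \<otimes> h2) \<otimes> p"
      using assms(1) eng by (simp add: m_assoc)
    finally show ?case using eng by simp
  qed (use assms H_sub in auto)
  then show ?thesis by blast
qed

text \<open>A left descent of \<open>p \<otimes> c\<close> in \<open>H\<close> lies in
  \<open>J\<close> and in \<open>K\<close>, hence is \<open>s\<close>. As \<open>s\<close> is no
  left descent of \<open>p\<close> and commutes with it, exchange would make \<open>s\<close> a left
  descent of \<open>c\<close>.\<close>

lemma mem_quot_L_mult_gen:
  assumes c: "c \<in> parabolic J" "c \<in> quot_L H" and p: "p \<in> commuting_gens s" "p \<noteq> s"
    and len_pc: "len (p \<otimes> c) = Suc (len c)"
  shows "p \<otimes> c \<in> quot_L H"
proof -
  have cc: "c \<in> carrier W" using c by (simp add: quot_L_def)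
  have pS: "p \<in> S" "p \<in> J" "p \<in> carrier W" "s \<otimes> p = p \<otimes> s" using comm_mem[OF p(1)] by auto
  have "len (r \<otimes> (p \<otimes> c)) = Suc (len (p \<otimes> c))" if r: "r \<in> H" for r
  proof (rule ccontr)
    assume "len (r \<otimes> (p \<otimes> c)) \<noteq> Suc (len (p \<otimes> c))"
    then have less: "len (r \<otimes> (p \<otimes> c)) < len (p \<otimes> c)"
      using len_gen_mult_cases[of "p \<otimes> c" r] r H_sub pS cc by auto
    have "p \<otimes> c \<in> parabolic J" using c pS parabolic_mult parabolic_gen by blast
    then have "r \<in> J"
      using left_descent_Supp[of "p \<otimes> c" r] less r H_sub J_sub by (auto simp: parabolic_iff)
    then have rs: "r = s" using r H_sub_K J_Int_K H_Int_comm by blast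
    have "s \<otimes> p \<noteq> \<one>" using mult_gen_eq_one[OF gen_closed[OF s_mem(1)] pS(1)] p by blast
    then have "\<not> len (s \<otimes> p) < len p" using pS s_mem by simp
    then obtain y where y: "y \<preceq> c" "len y < len c" "s \<otimes> (p \<otimes> c) = p \<otimes> y"
      using exchange_mult_left[of p c s] less rs pS cc s_mem by auto
    have yc: "y \<in> carrier W" using bruhat_le_carrier y by blast
    have "p \<otimes> (s \<otimes> c) = p \<otimes> y"
      using y(3) pS s_mem cc by (metis gen_closed m_assoc)
    then have "s \<otimes> c = y" using pS s_mem cc yc by simp
    then show False using y(2) c(2) s_mem by (auto simp: quot_L_iff[OF H_sub])
  qed
  then show ?thesis using cc pS by (auto simp: quot_L_iff[OF H_sub])
qed

text \<open>The new triple is \<open>a1\<close>, \<open>g \<otimes> b\<close>,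
  \<open>p \<otimes> c\<close>, where \<open>a' = a1 \<otimes> g\<close> with \<open>g\<close> in
  \<open>W_H\<close>. The equation between lengths says, without subtraction, that
  \<open>len (M b) - len b\<close> is preserved. The assumption on elements of \<open>W_H\<close>
  below the product keeps the new middle factor in the domain of \<open>M\<close>.\<close>

lemma move_right:
  assumes ad: "adapted a b c"
    and dom: "\<And>x. x \<in> parabolic H \<Longrightarrow> x \<preceq> a \<otimes> b \<otimes> c \<Longrightarrow> x \<preceq> v"
    and p: "p \<in> commuting_gens s" "p \<noteq> s" and less: "len (a \<otimes> b \<otimes> p) < len (a \<otimes> b)"
  shows "\<exists>a1 b1 c1. adapted a1 b1 c1 \<and> a1 \<otimes> b1 \<otimes> c1 = a \<otimes> b \<otimes> c \<and>
    a1 \<otimes> M b1 \<otimes> c1 = a \<otimes> M b \<otimes> c \<and> len (M b1) + len b = len (M b) + len b1 \<and> len c < len c1"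
proof -
  note cl = adapted_closed[OF ad]
  have aK: "a \<in> parabolic K" and aH: "a \<in> quot_R H" and aA: "card (Supp a \<inter> H) \<le> 1"
    and adm: "\<And>\<alpha> x. \<lbrakk>\<alpha> \<in> Supp a \<inter> H; x \<in> lower v\<rbrakk> \<Longrightarrow> M (\<alpha> \<otimes> x) = \<alpha> \<otimes> M x"
    and bv: "b \<in> lower v" and cJ: "c \<in> parabolic J" and cH: "c \<in> quot_L H"
    and len_u: "len (a \<otimes> b \<otimes> c) = len a + len b + len c"
    using ad by (auto simp: adapted_def)
  have pS: "p \<in> S" "p \<notin> H" "p \<in> J" "p \<in> carrier W" "s \<otimes> p = p \<otimes> s"
    using comm_mem[OF p(1)] p(2) by auto
  have finA: "finite (Supp a \<inter> H)" using finite_Supp cl by blast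
  obtain y q where bq: "b = y \<otimes> q" and y: "y \<in> quot_R {s}" "y \<in> parabolic H"
    and q: "q = \<one> \<or> q = s" and len_b: "len b = len y + len q"
    using split_s[OF cl(4)] by blast
  have yc: "y \<in> carrier W" "q \<in> carrier W" using y q s_mem by (auto simp: quot_R_def)
  have qp: "q \<otimes> p = p \<otimes> q" using q pS by auto
  have "len (b \<otimes> p) = Suc (len b)" using len_mult_gen_outside[OF H_sub cl(4) pS(1,2)] .
  then obtain a' where a': "a' \<preceq> a" "len a' < len a" and abp: "a \<otimes> b \<otimes> p = a' \<otimes> b"
    using exchange_mult[OF cl(1,2) pS(1) less] by auto
  have a'c: "a' \<in> carrier W" and a'S: "Supp a' \<subseteq> Supp a"
    using bruhat_le_carrier[OF a'(1)] Supp_mono[OF a'(1)] by auto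
  \<comment> \<open>The case analysis needs a middle factor without right descent \<open>s\<close>,
    so \<open>q\<close>, which commutes with \<open>p\<close>, is cancelled.\<close>
  have ayp: "a \<otimes> y \<otimes> p = a' \<otimes> y"
  proof -
    have "a \<otimes> y \<otimes> p \<otimes> q = a' \<otimes> y \<otimes> q"
      using abp bq cl a'c yc pS qp by (simp add: m_assoc)
    then show ?thesis using cl a'c yc pS by simp
  qed
  have abpp: "a' \<otimes> b \<otimes> p = a \<otimes> b"
    using abp[symmetric] cl pS by simp
  have cases: "(\<forall>r\<in>H. p \<otimes> r = r \<otimes> p) \<or> y = \<one> \<or> (y \<in> Supp a \<inter> H \<and> y \<noteq> s)"
    by (rule commutation_cases[OF cl(1) aA y(2,1) p a'c a'S ayp])
  have a'_comm: "a' = a \<otimes> p" if "p \<otimes> b = b \<otimes> p"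
  proof -
    have "a' \<otimes> b = a \<otimes> p \<otimes> b" using abp that cl pS by (simp add: m_assoc)
    then show ?thesis using cl a'c pS by simp
  qed
  have Mbs: "M b = b \<otimes> s" if "y = \<one> \<or> y \<in> Supp a \<inter> H"
    unfolding bq using M_eq_mult_s[OF ad that q] .
  have a'M: "a' \<otimes> M b \<otimes> p = a \<otimes> M b"
  proof (cases "\<forall>r\<in>H. p \<otimes> r = r \<otimes> p")
    case True
    then have *: "p \<otimes> x = x \<otimes> p" if "x \<in> parabolic H" for x
      using commute_parabolic pS that by blast
    have "a' \<otimes> M b \<otimes> p = a \<otimes> (p \<otimes> M b) \<otimes> p"
      using a'_comm[OF *[OF cl(4)]] cl pS by (simp add: m_assoc)
    also have "\<dots> = a \<otimes> M b" using *[OF cl(6)] cl pS by (simp add: m_assoc)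
    finally show ?thesis .
  next
    case False
    then have "M b = b \<otimes> s" using cases Mbs by blast
    then have "a' \<otimes> M b \<otimes> p = (a' \<otimes> b \<otimes> p) \<otimes> s"
      using cl pS a'c s_mem by (simp add: m_assoc)
    then show ?thesis using abpp \<open>M b = b \<otimes> s\<close> cl s_mem by (simp add: m_assoc)
  qed
  obtain a1 g where a1: "a1 \<in> quot_R H" and g: "g \<in> parabolic H" and a'_eq: "a' = a1 \<otimes> g"
    using quot_R_decomp[OF H_sub a'c] by blast
  have a1c: "a1 \<in> carrier W" "g \<in> carrier W"
    using a1 g parabolic_closed[OF H_sub] by (auto simp: quot_R_def)
  have len_a': "len a' = len a1 + len g"
    using len_quot_R_mult[OF H_sub a1 g] a'_eq by simp
  have a1S: "Supp a1 \<subseteq> Supp a" and gS: "Supp g \<subseteq> Supp a \<inter> H"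
  proof -
    have "a1 \<preceq> a'" "g \<preceq> a'" using le_mult_if_len_add[of a1 g] a1c len_a' a'_eq by auto
    then show "Supp a1 \<subseteq> Supp a" "Supp g \<subseteq> Supp a \<inter> H"
      using Supp_mono a'S g by (fastforce simp: parabolic_iff[OF H_sub])+
  qed
  have g_cases: "g = \<one> \<or> g \<in> Supp a \<inter> H"
  proof (cases "Supp g = {}")
    case True
    then show ?thesis using Supp_empty_iff a1c by blast
  next
    case False
    then obtain r where r: "r \<in> Supp g" by blast
    then have "Supp a \<inter> H = {r}"
      using gS aA finA card_le_Suc0_iff_eq[OF finA] by auto
    then show ?thesis using parabolic_singleton[of r g] gS a1c H_sub by auto
  qed
  have len_ab: "len (a \<otimes> b) = len a + len b" using len_quot_R_mult[OF H_sub aH cl(4)] .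
  have "len (a \<otimes> b) = Suc (len (a' \<otimes> b))"
    using len_mult_gen_cases[of "a \<otimes> b" p] less abp cl pS by auto
  moreover have "len (a' \<otimes> b) \<le> len a' + len b" using len_mult_le a'c cl by blast
  \<comment> \<open>The chain \<open>len a + len b = 1 + len (a' \<otimes> b) \<le> 1 + len a' + len
    b \<le> len a + len b\<close> consists of equalities.\<close>
  ultimately have len_a: "len a = Suc (len a')" and len_a'b: "len (a' \<otimes> b) = len a' + len b"
    using len_ab a' by linarith+
  have gbH: "g \<otimes> b \<in> parabolic H" using g cl parabolic_mult by blast
  have len_gb: "len (g \<otimes> b) = len g + len b"
    using len_quot_R_mult[OF H_sub a1 gbH] a'_eq len_a'b len_a' a1c cl by (simp add: m_assoc)
  have u: "a1 \<otimes> (g \<otimes> b) \<otimes> (p \<otimes> c) = a \<otimes> b \<otimes> c"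
  proof -
    have "a1 \<otimes> (g \<otimes> b) \<otimes> (p \<otimes> c) = a' \<otimes> b \<otimes> p \<otimes> c"
      using a'_eq a1c cl pS by (simp add: m_assoc)
    then show ?thesis using abpp by simp
  qed
  \<comment> \<open>The left part has lost exactly one unit of length while the product is
    unchanged, so the right factor must gain one.\<close>
  have len_pc: "len (p \<otimes> c) = Suc (len c)"
  proof -
    have "len (a \<otimes> b \<otimes> c) \<le> len (a1 \<otimes> (g \<otimes> b)) + len (p \<otimes> c)"
      unfolding u[symmetric] using len_mult_le a1c cl pS by simp
    also have "len (a1 \<otimes> (g \<otimes> b)) = len a' + len b"
      using len_a'b a'_eq a1c cl by (simp add: m_assoc)
    finally show ?thesis
      using len_u len_a len_mult_le[of p c] cl pS by simp
  qed
  have len_sum: "len (a1 \<otimes> (g \<otimes> b) \<otimes> (p \<otimes> c)) = len a1 + len (g \<otimes> b) + len (p \<otimes> c)"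
    unfolding u using len_u len_a len_a' len_gb len_pc by simp
  have len_a1gb: "len (a1 \<otimes> (g \<otimes> b)) = len a1 + len (g \<otimes> b)"
    using len_quot_R_mult[OF H_sub a1 gbH] .
  have "g \<otimes> b \<preceq> a1 \<otimes> (g \<otimes> b)"
    using le_mult_if_len_add(2)[OF _ _ len_a1gb] a1c cl by simp
  also have "a1 \<otimes> (g \<otimes> b) \<preceq> a \<otimes> b \<otimes> c"
    using le_mult_if_len_add(1)[of "a1 \<otimes> (g \<otimes> b)" "p \<otimes> c"] len_sum len_a1gb u a1c cl pS by simp
  finally have "g \<otimes> b \<preceq> v" using dom gbH by blast
  then have gbv: "g \<otimes> b \<in> lower v" using a1c cl by (simp add: lower_def)
  have pcH: "p \<otimes> c \<in> quot_L H"
    using mem_quot_L_mult_gen[OF cJ cH p len_pc] .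
  have a1K: "a1 \<in> parabolic K"
    using a1S aK a1c by (auto simp: parabolic_iff[OF K_sub])
  have pcJ: "p \<otimes> c \<in> parabolic J" using cJ pS parabolic_gen parabolic_mult by blast
  have "card (Supp a1 \<inter> H) \<le> card (Supp a \<inter> H)"
    using a1S finA by (intro card_mono) auto
  then have ad1: "adapted a1 (g \<otimes> b) (p \<otimes> c)"
    using a1 a1K aA adm a1S gbv pcJ pcH len_sum unfolding adapted_def by auto
  have Mgb: "M (g \<otimes> b) = g \<otimes> M b"
    using g_cases adm bv cl by auto
  have "a1 \<otimes> M (g \<otimes> b) \<otimes> (p \<otimes> c) = a' \<otimes> M b \<otimes> p \<otimes> c"
    unfolding Mgb using a'_eq a1c cl pS by (simp add: m_assoc)
  then have Mu: "a1 \<otimes> M (g \<otimes> b) \<otimes> (p \<otimes> c) = a \<otimes> M b \<otimes> c"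
    using a'M by simp
  \<comment> \<open>Otherwise \<open>a' = a \<otimes> p\<close> gives
    \<open>a \<otimes> g = a1 \<otimes> p\<close>, of length at most \<open>len a - 1\<close>,
    although \<open>a\<close> in \<open>W^H\<close> makes \<open>a \<otimes> g\<close> longer than
    \<open>a\<close>.\<close>
  have no_comm: False if "g \<in> Supp a \<inter> H" "p \<otimes> b = b \<otimes> p" "p \<otimes> g = g \<otimes> p"
  proof -
    have gS': "g \<in> S" using that H_sub by blast
    have "a \<otimes> g = a \<otimes> p \<otimes> p \<otimes> g"
      using cl pS by simp
    also have "\<dots> = a1 \<otimes> g \<otimes> p \<otimes> g" using a'_comm[OF that(2)] a'_eq by simp
    also have "\<dots> = a1 \<otimes> p"
      using that(3)[symmetric] a1c pS gS' by (simp add: m_assoc)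
    finally have "a \<otimes> g = a1 \<otimes> p" .
    then have "len (a \<otimes> g) \<le> Suc (len a1)"
      using len_mult_le[of a1 p] a1c pS by simp
    moreover have "len (a \<otimes> g) = Suc (len a)"
      using aH that(1) by (auto simp: quot_R_iff[OF H_sub])
    ultimately show False using len_a len_a' gS' by simp
  qed
  have "len (M (g \<otimes> b)) + len b = len (M b) + len (g \<otimes> b)"
  proof (cases "g = \<one>")
    case True
    then show ?thesis using cl by simp
  next
    case False
    then have gA: "g \<in> Supp a \<inter> H" using g_cases by blast
    then have gS': "g \<in> S" using H_sub by blast
    have nall: "\<not> (\<forall>r\<in>H. p \<otimes> r = r \<otimes> p)"
      using no_comm[OF gA] gA commute_parabolic[OF pS(4)] cl(4) by blast
    \<comment> \<open>The support of \<open>a\<close> has only one letter in \<open>H\<close>, so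
      \<open>y\<close> would equal \<open>g\<close> and cancel in \<open>g \<otimes> b\<close>,
      against \<open>len_gb\<close>. What remains is \<open>b = q\<close>, where both
      \<open>b\<close> and \<open>M b\<close> lie in \<open>{\<one>, s}\<close> and \<open>g\<close>
      differs from \<open>s\<close>.\<close>
    have "\<not> y \<in> Supp a \<inter> H"
    proof
      assume "y \<in> Supp a \<inter> H"
      then have "y = g" using gA aA card_le_Suc0_iff_eq[OF finA] by auto
      then have "g \<otimes> b = q" using bq gS' yc by simp
      then show False using len_gb len_b gS' \<open>y = g\<close> by simp
    qed
    then have y1: "y = \<one>" using cases nall by blast
    then have bq': "b = q" using bq yc by simp
    have "g \<noteq> s" using no_comm[OF gA] bq' qp pS by auto
    have "g \<otimes> s \<noteq> \<one>" using mult_gen_eq_one[OF gen_closed[OF gS'] s_mem(1)] \<open>g \<noteq> s\<close> by blast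
    then have "len (g \<otimes> s) = 2"
      using len_mult_gen_cases[of g s] gS' s_mem by auto
    then have "len (g \<otimes> M b) = Suc (len (M b))"
      using Mbs y1 bq' q gS' s_mem by auto
    then show ?thesis using Mgb len_gb gS' by simp
  qed
  then show ?thesis
    using ad1 u Mu len_pc by (intro exI[of _ a1] exI[of _ "g \<otimes> b"] exI[of _ "p \<otimes> c"]) simp
qed

text \<open>As \<open>a \<otimes> y\<close> lies in \<open>W_K\<close>, its descents in
  \<open>J\<close> commute with \<open>s\<close>. Those other than \<open>s\<close> are excluded by
  assumption, and \<open>s\<close> because it lengthens \<open>y\<close> and lengths add over
  \<open>W^H\<close> times \<open>W_H\<close>.\<close>

lemma mult_mem_quot_R:
  assumes a: "a \<in> parabolic K" "a \<in> quot_R H" and y: "y \<in> parabolic H" "y \<in> quot_R {s}"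
    and nd: "\<And>p. \<lbrakk>p \<in> commuting_gens s; p \<noteq> s\<rbrakk> \<Longrightarrow> \<not> len (a \<otimes> y \<otimes> p) < len (a \<otimes> y)"
  shows "a \<otimes> y \<in> quot_R J"
proof -
  have c: "a \<in> carrier W" "y \<in> carrier W" using a y by (auto simp: quot_R_def)
  have "len (a \<otimes> y \<otimes> r) = Suc (len (a \<otimes> y))" if r: "r \<in> J" for r
  proof (rule ccontr)
    assume "len (a \<otimes> y \<otimes> r) \<noteq> Suc (len (a \<otimes> y))"
    then have less: "len (a \<otimes> y \<otimes> r) < len (a \<otimes> y)"
      using len_mult_gen_cases[of "a \<otimes> y" r] r J_sub c by auto
    have "y \<in> parabolic K" using y H_sub_K H_sub K_sub by (auto simp: parabolic_iff)
    then have "a \<otimes> y \<in> parabolic K" using a parabolic_mult by blast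
    then have "r \<in> K"
      using right_descent_Supp[of "a \<otimes> y" r] less r J_sub K_sub by (auto simp: parabolic_iff)
    then have "r \<in> commuting_gens s" using r J_Int_K by blast
    then have "r = s" using nd less by blast
    have "y \<otimes> s \<in> parabolic H" using y s_mem parabolic_gen parabolic_mult by blast
    then have "len (a \<otimes> y \<otimes> s) = len a + len (y \<otimes> s)"
      using len_quot_R_mult[OF H_sub a(2)] c s_mem by (simp add: m_assoc)
    moreover have "len (y \<otimes> s) = Suc (len y)" using y s_mem by (simp add: quot_R_iff)
    moreover have "len (a \<otimes> y) = len a + len y" using len_quot_R_mult[OF H_sub a(2) y(1)] .
    ultimately show False using less \<open>r = s\<close> by simp
  qed
  then show ?thesis using c by (auto simp: quot_R_iff[OF J_sub])
qed

text \<open>The product \<open>a \<otimes> y\<close> turns out to be minimal in its coset of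
  \<open>W_J\<close>, and uniqueness of parabolic decompositions identifies all parts. For the
  length, the same is shown for the split \<open>y1\<close>, \<open>q1\<close> of
  \<open>M b\<close>: a forbidden descent of \<open>a \<otimes> y1\<close> would produce one of
  \<open>a \<otimes> y\<close>.\<close>

lemma terminal:
  assumes ad: "adapted a b c"
    and nd: "\<And>p. \<lbrakk>p \<in> commuting_gens s; p \<noteq> s\<rbrakk> \<Longrightarrow> \<not> len (a \<otimes> b \<otimes> p) < len (a \<otimes> b)"
  shows "sys_map1 J H M (a \<otimes> b \<otimes> c) = a \<otimes> M b \<otimes> c"
    "len (a \<otimes> M b \<otimes> c) = len a + len (M b) + len c"
proof -
  note cl = adapted_closed[OF ad]
  have aK: "a \<in> parabolic K" and aH: "a \<in> quot_R H" and aA: "card (Supp a \<inter> H) \<le> 1"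
    and adm: "\<And>\<alpha> x. \<lbrakk>\<alpha> \<in> Supp a \<inter> H; x \<in> lower v\<rbrakk> \<Longrightarrow> M (\<alpha> \<otimes> x) = \<alpha> \<otimes> M x"
    and bv: "b \<in> lower v" and cJ: "c \<in> parabolic J" and cH: "c \<in> quot_L H"
    and len_u: "len (a \<otimes> b \<otimes> c) = len a + len b + len c"
    using ad by (auto simp: adapted_def)
  obtain y q where bq: "b = y \<otimes> q" and y: "y \<in> quot_R {s}" "y \<in> parabolic H"
    and q: "q = \<one> \<or> q = s" and len_b: "len b = len y + len q"
    using split_s[OF cl(4)] by blast
  have yc: "y \<in> carrier W" "q \<in> carrier W" using y q s_mem by (auto simp: quot_R_def)
  have qpar: "q \<in> parabolic J" "q \<in> parabolic H"
    using q s_mem parabolic_gen by auto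
  have len_a: "len (a \<otimes> x) = len a + len x" if "x \<in> parabolic H" for x
    using len_quot_R_mult[OF H_sub aH that] .
  have ndy: "\<not> len (a \<otimes> y \<otimes> p) < len (a \<otimes> y)" if p: "p \<in> commuting_gens s" "p \<noteq> s" for p
  proof
    assume less: "len (a \<otimes> y \<otimes> p) < len (a \<otimes> y)"
    have pS: "p \<in> S" "p \<otimes> q = q \<otimes> p" using comm_mem[OF p(1)] q by auto
    have "a \<otimes> b \<otimes> p = a \<otimes> y \<otimes> p \<otimes> q" using bq pS cl yc by (simp add: m_assoc)
    then have "len (a \<otimes> b \<otimes> p) \<le> len (a \<otimes> y \<otimes> p) + len q"
      using len_mult_le[of "a \<otimes> y \<otimes> p" q] cl yc pS by simp
    then have "len (a \<otimes> b \<otimes> p) < len (a \<otimes> b)"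
      using less len_a[OF y(2)] len_a[OF cl(4)] len_b by simp
    then show False using nd p by blast
  qed
  have ayJ: "a \<otimes> y \<in> quot_R J"
    using mult_mem_quot_R[OF aK aH y(2,1) ndy] .
  have qcJ: "q \<otimes> c \<in> parabolic J" using qpar cJ parabolic_mult by blast
  have u: "a \<otimes> b \<otimes> c = (a \<otimes> y) \<otimes> (q \<otimes> c)" using bq cl yc by (simp add: m_assoc)
  have "min_R J (a \<otimes> b \<otimes> c) = a \<otimes> y" "par_R J (a \<otimes> b \<otimes> c) = q \<otimes> c"
    unfolding u using min_R_par_R_eq[OF J_sub ayJ qcJ] by auto
  moreover have "min_R H (a \<otimes> y) = a" "par_R H (a \<otimes> y) = y"
    using min_R_par_R_eq[OF H_sub aH y(2)] by auto
  moreover have "par_L H (q \<otimes> c) = q" "min_L H (q \<otimes> c) = c"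
    using min_L_par_L_eq[OF H_sub cH qpar(2)] by auto
  ultimately show "sys_map1 J H M (a \<otimes> b \<otimes> c) = a \<otimes> M b \<otimes> c"
    by (simp add: sys_map1_def bq)
  obtain y1 q1 where Mb: "M b = y1 \<otimes> q1" and y1: "y1 \<in> quot_R {s}" "y1 \<in> parabolic H"
    and q1: "q1 = \<one> \<or> q1 = s" and len_Mb: "len (M b) = len y1 + len q1"
    using split_s[OF cl(6)] by blast
  have y1c: "y1 \<in> carrier W" "q1 \<in> carrier W" using y1 q1 s_mem by (auto simp: quot_R_def)
  have q1par: "q1 \<in> parabolic J" "q1 \<in> parabolic H"
    using q1 s_mem parabolic_gen by auto
  have ndy1: "\<not> len (a \<otimes> y1 \<otimes> p) < len (a \<otimes> y1)" if p: "p \<in> commuting_gens s" "p \<noteq> s" for p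
  proof
    assume less: "len (a \<otimes> y1 \<otimes> p) < len (a \<otimes> y1)"
    have pS: "p \<in> S" "p \<notin> H" "p \<in> carrier W" using comm_mem[OF p(1)] p by auto
    have "len (y1 \<otimes> p) = Suc (len y1)" using len_mult_gen_outside[OF H_sub y1(2) pS(1,2)] .
    then obtain a' where a': "a' \<preceq> a" "len a' < len a" and eq: "a \<otimes> y1 \<otimes> p = a' \<otimes> y1"
      using exchange_mult[OF cl(1) y1c(1) pS(1) less] by auto
    have a'c: "a' \<in> carrier W" and a'S: "Supp a' \<subseteq> Supp a"
      using bruhat_le_carrier[OF a'(1)] Supp_mono[OF a'(1)] by auto
    \<comment> \<open>In these cases \<open>M\<close> acts on \<open>M b\<close> as right
      multiplication by \<open>s\<close>, so \<open>b\<close> and \<open>M b\<close> differ only in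
      the factor from \<open>{\<one>, s}\<close> and \<open>y = y1\<close>.\<close>
    have False if y1': "y1 = \<one> \<or> y1 \<in> Supp a \<inter> H"
    proof -
      have "b = M (y1 \<otimes> q1)" using M_lower[OF bv] Mb by simp
      also have "\<dots> = y1 \<otimes> q1 \<otimes> s" using M_eq_mult_s[OF ad y1' q1] .
      finally have "y \<otimes> q = y1 \<otimes> (q1 \<otimes> s)" using bq y1c s_mem by (simp add: m_assoc)
      moreover have "q \<in> parabolic {s}" "q1 \<otimes> s \<in> parabolic {s}"
        using q q1 parabolic_gen[of s "{s}"] s_mem by auto
      ultimately have "y = y1" using quot_R_unique[of "{s}" y y1] y y1 s_mem by auto
      then show False using ndy[OF p] less by blast
    qed
    then have comm: "\<forall>r\<in>H. p \<otimes> r = r \<otimes> p"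
      using commutation_cases[OF cl(1) aA y1(2,1) p a'c a'S eq] by blast
    have pc: "p \<otimes> x = x \<otimes> p" if "x \<in> parabolic H" for x
      using commute_parabolic[OF pS(3) comm that] .
    have "a \<otimes> p \<otimes> y1 = a' \<otimes> y1" using eq pc[OF y1(2)] cl y1c pS by (simp add: m_assoc)
    then have "a \<otimes> p = a'" using cl y1c pS a'c by simp
    then have "a \<otimes> y \<otimes> p = a' \<otimes> y" using pc[OF y(2)] cl yc pS by (simp add: m_assoc flip: \<open>a \<otimes> p = a'\<close>)
    then have "len (a \<otimes> y \<otimes> p) \<le> len a' + len y" using len_mult_le a'c yc by simp
    then show False using ndy[OF p] len_a[OF y(2)] a'(2) by simp
  qed
  have "a \<otimes> y1 \<in> quot_R J"
    using mult_mem_quot_R[OF aK aH y1(2,1) ndy1] .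
  moreover have "q1 \<otimes> c \<in> parabolic J" using q1par cJ parabolic_mult by blast
  ultimately have "len (a \<otimes> y1 \<otimes> (q1 \<otimes> c)) = len (a \<otimes> y1) + len (q1 \<otimes> c)"
    using len_quot_R_mult[OF J_sub] by blast
  moreover have "len (q1 \<otimes> c) = len c + len q1" using len_quot_L_mult[OF H_sub cH q1par(2)] .
  moreover have "a \<otimes> M b \<otimes> c = a \<otimes> y1 \<otimes> (q1 \<otimes> c)" using Mb cl y1c by (simp add: m_assoc)
  ultimately show "len (a \<otimes> M b \<otimes> c) = len a + len (M b) + len c"
    using len_Mb len_a[OF y1(2)] by simp
qed

theorem adapted_sys_map1:
  assumes "adapted a b c"
    and "\<And>x. x \<in> parabolic H \<Longrightarrow> x \<preceq> a \<otimes> b \<otimes> c \<Longrightarrow> x \<preceq> v"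
  shows "sys_map1 J H M (a \<otimes> b \<otimes> c) = a \<otimes> M b \<otimes> c"
    "len (a \<otimes> M b \<otimes> c) = len a + len (M b) + len c"
proof -
  define u where "u = a \<otimes> b \<otimes> c"
  have "sys_map1 J H M (a \<otimes> b \<otimes> c) = a \<otimes> M b \<otimes> c \<and>
    len (a \<otimes> M b \<otimes> c) = len a + len (M b) + len c"
    if "adapted a b c" "a \<otimes> b \<otimes> c = u" for a b c
    using that
  proof (induction "len u - len c" arbitrary: a b c rule: less_induct)
    case less
    have dom: "\<And>x. x \<in> parabolic H \<Longrightarrow> x \<preceq> a \<otimes> b \<otimes> c \<Longrightarrow> x \<preceq> v"
      using assms(2) less.prems u_def by simp
    show ?case
    proof (cases "\<exists>p\<in>commuting_gens s. p \<noteq> s \<and> len (a \<otimes> b \<otimes> p) < len (a \<otimes> b)")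
      case False
      then show ?thesis using terminal[OF less.prems(1)] by blast
    next
      case True
      then obtain a1 b1 c1 where *: "adapted a1 b1 c1" "a1 \<otimes> b1 \<otimes> c1 = a \<otimes> b \<otimes> c"
        "a1 \<otimes> M b1 \<otimes> c1 = a \<otimes> M b \<otimes> c" "len (M b1) + len b = len (M b) + len b1" "len c < len c1"
        using move_right[OF less.prems(1) dom] by blast
      have len1: "len u = len a1 + len b1 + len c1" and len: "len u = len a + len b + len c"
        using * less.prems by (auto simp: adapted_def)
      then have "len u - len c1 < len u - len c" using *(5) by linarith
      then have "sys_map1 J H M (a1 \<otimes> b1 \<otimes> c1) = a1 \<otimes> M b1 \<otimes> c1"
        "len (a1 \<otimes> M b1 \<otimes> c1) = len a1 + len (M b1) + len c1"
        using less.hyps[of c1 a1 b1] * less.prems by auto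
      \<comment> \<open>Additivity returns to the original triple because the shift has changed
        \<open>len b\<close> and \<open>len (M b)\<close> by the same amount.\<close>
      then show ?thesis using * len len1 by simp
    qed
  qed
  then show "sys_map1 J H M (a \<otimes> b \<otimes> c) = a \<otimes> M b \<otimes> c"
    "len (a \<otimes> M b \<otimes> c) = len a + len (M b) + len c"
    using assms(1) u_def by auto
qed

end

subsection \<open>Systems\<close>

context coxeter_system
begin

text \<open>The maximum is the Demazure product of the word.\<close>

lemma subword_maximum:
  assumes "xs \<in> lists S"
  shows "\<exists>ms. subseq ms xs \<and> (\<forall>ys. subseq ys xs \<longrightarrow> word_prod W ys \<preceq> word_prod W ms)"
  using assms
proof (induction xs rule: rev_induct)
  case (snoc s xs)
  then have s: "s \<in> S" and xs: "xs \<in> lists S" by auto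
  then obtain ms where ms: "subseq ms xs" and max: "\<And>ys. subseq ys xs \<Longrightarrow> word_prod W ys \<preceq> word_prod W ms"
    using snoc.IH by blast
  have msS: "ms \<in> lists S" using subseq_lists[OF ms xs] .
  let ?m = "word_prod W ms"
  have mc: "?m \<in> carrier W" using msS by blast
  obtain ns where ns: "subseq ns (xs @ [s])" "?m \<preceq> word_prod W ns" "?m \<otimes> s \<preceq> word_prod W ns"
  proof (cases "len ?m < len (?m \<otimes> s)")
    case True
    then have "?m \<preceq> ?m \<otimes> s" using bruhat_le_gen mc s by blast
    moreover have "subseq (ms @ [s]) (xs @ [s])" using ms by simp
    moreover have "word_prod W (ms @ [s]) = ?m \<otimes> s" using msS s by simp
    ultimately show thesis using that[of "ms @ [s]"] mc s by simp
  next
    case False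
    then have "?m \<otimes> s \<preceq> ?m"
      using bruhat_le_gen'[OF mc s] len_mult_gen_cases[OF mc s] by simp
    moreover have "subseq ms (xs @ [s])" using ms by (simp add: subseq_rev_drop_many)
    ultimately show thesis using that[of ms] mc by blast
  qed
  have "word_prod W ys \<preceq> word_prod W ns" if "subseq ys (xs @ [s])" for ys
    using subseq_snoc[OF that]
  proof
    assume "subseq ys xs"
    then show ?thesis using max ns bruhat_le_trans by blast
  next
    assume "\<exists>ys'. ys = ys' @ [s] \<and> subseq ys' xs"
    then obtain ys' where ys': "ys = ys' @ [s]" "subseq ys' xs" by blast
    then have "ys' \<in> lists S" using subseq_lists xs by blast
    then have "word_prod W ys = word_prod W ys' \<otimes> s" using ys' s by simp
    then show ?thesis
      using bruhat_le_mult_gen[OF max[OF ys'(2)] s] ns bruhat_le_trans by metis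
  qed
  then show ?case using ns by blast
qed (intro exI[of _ "[]"], auto dest: list_emb_Nil2)

text \<open>The maximum comes from a reduced word of \<open>u\<close> stripped of all letters
  outside \<open>H\<close>. A subword spelling some \<open>x\<close> in \<open>W_H\<close> may still
  contain other letters, but reducing it by deletions leaves only letters of the support of
  \<open>x\<close>.\<close>

lemma max_par_properties:
  assumes H: "H \<subseteq> S" and u: "u \<in> carrier W"
  shows "max_par H u \<in> parabolic H" "max_par H u \<preceq> u"
    "\<And>x. \<lbrakk>x \<in> parabolic H; x \<preceq> u\<rbrakk> \<Longrightarrow> x \<preceq> max_par H u"
proof -
  obtain us where us: "us \<in> lists S" "length us = len u" "word_prod W us = u"
    using reduced_word u by blast
  let ?hs = "filter (\<lambda>r. r \<in> H) us"
  have hs: "subseq ?hs us" "?hs \<in> lists S" "?hs \<in> lists H"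
    using us by (auto simp: in_lists_conv_set)
  obtain ms where ms: "subseq ms ?hs"
    and max: "\<And>ys. subseq ys ?hs \<Longrightarrow> word_prod W ys \<preceq> word_prod W ms"
    using subword_maximum[OF hs(2)] by blast
  let ?m = "word_prod W ms"
  have "subseq ms us" using ms hs(1) by (rule subseq_order.order_trans)
  then have mu: "?m \<preceq> u" using le_of_subword[of us ms] us by simp
  have "ms \<in> lists H" using subseq_lists[OF ms hs(3)] .
  then have mH: "?m \<in> parabolic H"
    unfolding parabolic_def mem_generate_iff[OF H] by blast
  have mmax: "x \<preceq> ?m" if x: "x \<in> parabolic H" "x \<preceq> u" for x
  proof -
    obtain ys where ys: "subseq ys us" "word_prod W ys = x"
      using subword_of_le[of x us] x us by blast
    have ysS: "ys \<in> lists S" using subseq_lists[OF ys(1) us(1)] .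
    obtain zs where zs: "subseq zs ys" "word_prod W zs = x" "length zs = len x"
      using reduced_subword[OF ysS] ys by auto
    have zsS: "zs \<in> lists S" using subseq_lists[OF zs(1) ysS] .
    have "set zs \<subseteq> H" using Supp_reduced_word[OF zsS] zs x by (simp add: parabolic_iff[OF H])
    then have "filter (\<lambda>r. r \<in> H) zs = zs" by (simp add: filter_id_conv subset_iff)
    moreover have "subseq (filter (\<lambda>r. r \<in> H) zs) ?hs"
      using subseq_order.order_trans[OF zs(1) ys(1)] by (rule subseq_filter)
    ultimately show ?thesis using max[of zs] zs by simp
  qed
  have "max_par H u = ?m"
    unfolding max_par_def
  proof (rule the_equality)
    show "?m \<in> lower u \<inter> parabolic H \<and> (\<forall>y\<in>lower u \<inter> parabolic H. ?m \<preceq> y \<longrightarrow> y = ?m)"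
      using mu mH mmax bruhat_le_carrier bruhat_le_antisym by (auto simp: lower_def)
  next
    fix x assume x: "x \<in> lower u \<inter> parabolic H \<and> (\<forall>y\<in>lower u \<inter> parabolic H. x \<preceq> y \<longrightarrow> y = x)"
    moreover have "?m \<in> lower u \<inter> parabolic H"
      using mu mH bruhat_le_carrier by (auto simp: lower_def)
    ultimately show "x = ?m" using mmax[of x] by (auto simp: lower_def)
  qed
  with mu mH mmax show "max_par H u \<in> parabolic H" "max_par H u \<preceq> u"
    "\<And>x. \<lbrakk>x \<in> parabolic H; x \<preceq> u\<rbrakk> \<Longrightarrow> x \<preceq> max_par H u" by auto
qed

lemma complement_properties:
  assumes "commuting_gens s \<subseteq> J" "J \<subseteq> S"
  shows "complement s J \<subseteq> S" "J \<inter> complement s J = commuting_gens s"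
proof -
  have "commuting_gens s \<subseteq> S" by (auto simp: commuting_gens_def)
  then have "complement s J = (S - J) \<union> commuting_gens s"
    unfolding complement_def using assms by (intro the_equality) blast+
  then show "complement s J \<subseteq> S" "J \<inter> complement s J = commuting_gens s"
    using assms \<open>commuting_gens s \<subseteq> S\<close> by auto
qed

lemma coset_parts:
  assumes "J \<subseteq> S" "u \<in> carrier W"
  shows "min_R J u \<in> quot_R J" "par_R J u \<in> parabolic J" "u = min_R J u \<otimes> par_R J u"
    "min_L J u \<in> quot_L J" "par_L J u \<in> parabolic J" "u = par_L J u \<otimes> min_L J u"
proof -
  obtain x y where "x \<in> quot_R J" "y \<in> parabolic J" "u = x \<otimes> y"
    using quot_R_decomp assms by blast
  then show "min_R J u \<in> quot_R J" "par_R J u \<in> parabolic J" "u = min_R J u \<otimes> par_R J u"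
    using min_R_par_R_eq[OF assms(1)] by auto
  obtain x y where "x \<in> quot_L J" "y \<in> parabolic J" "u = y \<otimes> x"
    using quot_L_decomp assms by blast
  then show "min_L J u \<in> quot_L J" "par_L J u \<in> parabolic J" "u = par_L J u \<otimes> min_L J u"
    using min_L_par_L_eq[OF assms(1)] by auto
qed

text \<open>S1 is inherited by lower elements; this serves the comparison of the two definitions of
  the map. A word of \<open>w\<close> composed of letters of \<open>K\<close> followed by letters of
  \<open>J\<close> restricts to such a word of \<open>u\<close>. The minimal representative of
  \<open>u\<close> is that of the \<open>K\<close>-part, hence below it.\<close>

lemma min_R_mono_parabolic:
  assumes J: "J \<subseteq> S" and K: "K \<subseteq> S" and le: "u \<preceq> w" and w: "min_R J w \<in> parabolic K"
  shows "min_R J u \<in> parabolic K"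
proof -
  have uw: "u \<in> carrier W" "w \<in> carrier W" using bruhat_le_carrier[OF le] by auto
  let ?x = "min_R J w" and ?y = "par_R J w"
  have xy: "?x \<in> carrier W" "?y \<in> carrier W"
    using coset_parts[OF J uw(2)] parabolic_closed[OF J] by (auto simp: quot_R_def)
  obtain xs ys where xs: "xs \<in> lists S" "length xs = len ?x" "word_prod W xs = ?x"
    and ys: "ys \<in> lists S" "length ys = len ?y" "word_prod W ys = ?y"
    using reduced_word xy by metis
  have "word_prod W (xs @ ys) = w" using coset_parts(3)[OF J uw(2)] xs ys by simp
  then obtain zs where zs: "subseq zs (xs @ ys)" "word_prod W zs = u"
    using subword_of_le[of u "xs @ ys"] le xs ys by auto
  then obtain z1 z2 where z: "zs = z1 @ z2" "subseq z1 xs" "subseq z2 ys"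
    using subseq_appendE by metis
  have zS: "z1 \<in> lists S" "z2 \<in> lists S" using subseq_lists z xs ys by blast+
  have "xs \<in> lists K" "ys \<in> lists J"
    using Supp_reduced_word[of xs] Supp_reduced_word[of ys] xs ys w coset_parts(2)[OF J uw(2)]
    by (auto simp: parabolic_iff[OF K] parabolic_iff[OF J] in_lists_conv_set)
  then have "z1 \<in> lists K" "z2 \<in> lists J" using subseq_lists z by blast+
  then have z1: "word_prod W z1 \<in> parabolic K" and z2: "word_prod W z2 \<in> parabolic J"
    unfolding parabolic_def mem_generate_iff[OF K] mem_generate_iff[OF J] by blast+
  obtain x y where x: "x \<in> quot_R J" and y: "y \<in> parabolic J" and z1': "word_prod W z1 = x \<otimes> y"
    using quot_R_decomp[OF J, of "word_prod W z1"] zS by blast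
  have c: "x \<in> carrier W" "y \<in> carrier W"
    using x y parabolic_closed[OF J] by (auto simp: quot_R_def)
  have "u = x \<otimes> (y \<otimes> word_prod W z2)" using zs z z1' zS c by (simp add: m_assoc)
  moreover have "y \<otimes> word_prod W z2 \<in> parabolic J" using y z2 parabolic_mult by blast
  ultimately have "min_R J u = x" using min_R_par_R_eq[OF J x] by simp
  moreover have "x \<preceq> word_prod W z1"
    using le_mult_if_len_add(1)[OF c len_quot_R_mult[OF J x y]] z1' by simp
  ultimately show ?thesis
    using Supp_mono z1 c by (fastforce simp: parabolic_iff[OF K])
qed

text \<open>If some \<open>r \<noteq> s\<close> in \<open>H\<close> commutes with \<open>s = M e\<close>, then \<open>W\<^sub>H = {e, s, r, sr}\<close> and \<open>M\<close> has no
  choice but to be left multiplication by \<open>s\<close>.\<close>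

lemma mult_matching_of_commuting:
  assumes match: "matching (lower v) M" and v: "v \<in> parabolic {s, r}" and Ms: "M \<one> = s"
    and s: "s \<in> S" "s \<in> lower v" and r: "r \<in> S" "r \<noteq> s" and comm: "s \<otimes> r = r \<otimes> s"
  shows "mult_matching v M"
proof -
  have H: "{s, r} \<subseteq> S" using s r by blast
  have vc: "v \<in> carrier W" using v parabolic_closed H by blast
  have four: "x \<in> {\<one>, s, r, s \<otimes> r}" if x: "x \<in> parabolic {s, r}" for x
  proof -
    have "x \<in> generate W {s, r}" using x by (simp add: parabolic_def)
    then show ?thesis
    proof induction
      case (inv h)
      then show ?case using s r by auto
    next
      case (eng h1 h2)
      have [simp]: "r \<otimes> s = s \<otimes> r" using comm by simp
      have [simp]: "r \<otimes> (s \<otimes> x) = s \<otimes> (r \<otimes> x)" "s \<otimes> (r \<otimes> r) = s" if "x \<in> carrier W" for x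
        using that s r comm by (simp_all flip: m_assoc)
      show ?case using eng s r by (auto simp: m_assoc)
    qed auto
  qed
  have low: "x \<in> carrier W \<and> x \<in> parabolic {s, r}" if "x \<in> lower v" for x
    using that v Supp_mono[of x v] by (auto simp: lower_def parabolic_iff[OF H])
  have M: "M x \<in> lower v" "M (M x) = x" "M x \<noteq> x" if "x \<in> lower v" for x
    using match that by (auto simp: matching_def covered_in_def)
  have one: "\<one> \<in> lower v" using vc by (simp add: lower_def)
  have Ms': "M s = \<one>" using M(2)[OF one] Ms by simp
  have sr: "s \<noteq> \<one>" "r \<noteq> \<one>" using s r by auto
  \<comment> \<open>The values \<open>\<one>\<close> and \<open>s\<close> are taken by each other,
    and a matching has no fixed point, so one candidate is left.\<close>
  have Mr: "M r = s \<otimes> r" if "r \<in> lower v"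
  proof -
    have "M r \<in> {\<one>, s, r, s \<otimes> r}" using four low M(1)[OF that] by blast
    moreover have "M r \<noteq> \<one>" using M(2)[OF that] Ms r by metis
    moreover have "M r \<noteq> s" using M(2)[OF that] Ms' sr by metis
    moreover have "M r \<noteq> r" using M(3)[OF that] .
    ultimately show ?thesis by blast
  qed
  have "s \<otimes> r \<noteq> \<one>" using mult_gen_eq_one[of s r] s r by auto
  then have len_sr: "len (s \<otimes> r) = 2" using len_mult_gen_cases[of s r] s r by auto
  have mult: "M x = s \<otimes> x" if x: "x \<in> lower v" for x
  proof -
    consider "x = \<one>" | "x = s" | "x = r" | "x = s \<otimes> r" using four low x by blast
    then show ?thesis
    proof cases
      case 4
      have "r \<preceq> s \<otimes> r" using le_mult_if_len_add(2)[of s r] s r len_sr by simp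
      then have "r \<in> lower v" using lower_down_closed x 4 by blast
      then show ?thesis using Mr M(2)[of r] 4 s r by simp
    qed (use Ms Ms' Mr s x in auto)
  qed
  have "s \<in> D_L v"
  proof -
    consider "v = \<one>" | "v = s" | "v = r" | "v = s \<otimes> r" using four v by blast
    then show ?thesis
    proof cases
      case 1
      then show ?thesis using s bruhat_le_len[of s \<one>] by (simp add: lower_def)
    next
      case 3
      then have "s = r" using s r bruhat_le_len[of s r] by (simp add: lower_def)
      then show ?thesis using r by simp
    qed (use s r len_sr in \<open>auto simp: D_L_def\<close>)
  qed
  with mult show ?thesis unfolding mult_matching_def by blast
qed

text \<open>A partner of \<open>\<one>\<close> has length one, so \<open>M \<one>\<close> is a
  letter, and it lies in \<open>H\<close> because it is below \<open>v\<close>. S0 enters by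
  contradiction: a further letter of \<open>H\<close> commuting with it would make \<open>M\<close>
  a multiplication matching although \<open>H\<close> has two elements.\<close>

lemma system_basics:
  assumes sys: "system_for w J H M" and w: "w \<in> carrier W"
  defines "s \<equiv> M \<one>" and "v \<equiv> max_par H w"
  shows "H \<subseteq> S" "J \<subseteq> S" "compl_of J M \<subseteq> S" "J \<inter> compl_of J M = commuting_gens s"
    "H \<inter> commuting_gens s = {s}" "v \<in> parabolic H" "matching (lower v) M"
    "\<And>r r'. \<lbrakk>r \<in> H; r' \<in> H; r \<noteq> s; r' \<noteq> s\<rbrakk> \<Longrightarrow> r = r'"
proof -
  show H: "H \<subseteq> S" and J: "J \<subseteq> S" and match: "matching (lower v) M"
    using sys by (auto simp: system_for_def v_def)
  have C: "commuting_gens s \<subseteq> J" and mm: "mult_matching v M \<longleftrightarrow> card H = 1" and cH: "card H \<in> {1, 2}"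
    using sys by (auto simp: system_for_def s_def v_def)
  then show "compl_of J M \<subseteq> S" "J \<inter> compl_of J M = commuting_gens s"
    using complement_properties J by (auto simp: s_def)
  show v: "v \<in> parabolic H" using max_par_properties H w by (simp add: v_def)
  then have vc: "v \<in> carrier W" "Supp v \<subseteq> H" by (auto simp: parabolic_iff[OF H])
  have one: "\<one> \<in> lower v" using vc by (simp add: lower_def)
  then have sv: "s \<in> lower v" and cov: "\<one> \<lhd>\<^sub>B s \<or> s \<lhd>\<^sub>B \<one>"
    using match by (auto simp: matching_def s_def covered_in_lower_iff)
  then have sS: "s \<in> S"
    using len_eq_1_iff by (auto simp: covered_iff lower_def)
  then have sH: "s \<in> H" using sv vc by (auto simp: lower_def Supp_def)
  have sC: "s \<in> commuting_gens s" using sS by (simp add: commuting_gens_def)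
  have fin: "finite (H - {s})" using cH card.infinite by fastforce
  have "card (H - {s}) \<le> 1" using cH sH fin by (auto simp: card_Diff_singleton)
  then show other: "r = r'" if "r \<in> H" "r' \<in> H" "r \<noteq> s" "r' \<noteq> s" for r r'
    using that card_le_Suc0_iff_eq[OF fin] by auto
  have "r = s" if r: "r \<in> H" "r \<in> commuting_gens s" for r
  proof (rule ccontr)
    assume "r \<noteq> s"
    then have Hsr: "H = {s, r}" using other r sH by blast
    then have "card H = 2" using \<open>r \<noteq> s\<close> by simp
    moreover have "mult_matching v M"
    proof (rule mult_matching_of_commuting[OF match])
      show "v \<in> parabolic {s, r}" using v unfolding Hsr .
      show "M \<one> = s" unfolding s_def ..
      show "s \<in> S" "s \<in> lower v" "r \<noteq> s" by fact+
      show "r \<in> S" "s \<otimes> r = r \<otimes> s" using r(2) unfolding commuting_gens_def by blast+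
    qed
    ultimately show False using mm by simp
  qed
  then show "H \<inter> commuting_gens s = {s}" using sH sC by blast
qed

lemma first_kind_matching_of_system:
  assumes "system_for w J H M" "w \<in> carrier W" "first_kind J H M"
  shows "first_kind_matching W S J (compl_of J M) H (M \<one>) (max_par H w) M"
  using system_basics[OF assms(1,2)] assms(3)
  by unfold_locales (auto simp: first_kind_def)

text \<open>Passing to the opposite group exchanges \<open>J\<close> and \<open>K\<close> and hence the two kinds of systems.\<close>

lemma opposite_matching_of_system:
  assumes "system_for w J H M" "w \<in> carrier W" "second_kind J H"
  shows "first_kind_matching (opp W) S (compl_of J M) J H (M \<one>) (max_par H w) M"
proof -
  interpret op: coxeter_system "opp W" S by (rule coxeter_system_opp)
  note b = system_basics[OF assms(1,2)]
  show ?thesis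
    using b assms(3)
    by unfold_locales (auto simp: second_kind_def opp_commuting_gens)
qed

section \<open>Transfer to system factorizations\<close>

text \<open>The interval and the two larger domains enter the argument through this consequence
  only, so all are treated at once.\<close>

lemma dom_max_par:
  assumes H: "H \<subseteq> S" and w: "w \<in> carrier W" and u: "u \<in> lower w \<or> u \<in> carrier W \<and> max_par H u \<preceq> max_par H w"
    and x: "x \<in> parabolic H" "x \<preceq> u"
  shows "x \<preceq> max_par H w"
  using u
proof
  assume "u \<in> lower w"
  then show ?thesis
    using max_par_properties(3)[OF H w x(1)] x(2) bruhat_le_trans by (auto simp: lower_def)
next
  assume u: "u \<in> carrier W \<and> max_par H u \<preceq> max_par H w"
  then have "x \<preceq> max_par H u" using max_par_properties(3)[OF H _ x] by blast
  then show ?thesis using u bruhat_le_trans by blast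
qed

lemma middle_factor_le:
  assumes c: "a \<in> carrier W" "b \<in> carrier W" "c \<in> carrier W"
    and len: "len (a \<otimes> b \<otimes> c) = len a + len b + len c"
  shows "b \<preceq> a \<otimes> b \<otimes> c"
proof -
  have "len (a \<otimes> b \<otimes> c) \<le> len (a \<otimes> b) + len c" "len (a \<otimes> b) \<le> len a + len b"
    using len_mult_le c by auto
  then have "b \<preceq> a \<otimes> b" "a \<otimes> b \<preceq> a \<otimes> b \<otimes> c"
    using le_mult_if_len_add(2)[of a b] le_mult_if_len_add(1)[of "a \<otimes> b" c] c len by auto
  then show ?thesis using bruhat_le_trans by blast
qed

text \<open>If \<open>b' = b \<otimes> t\<close>, then \<open>a \<otimes> b' \<otimes> c\<close>
  arises from \<open>a \<otimes> b \<otimes> c\<close> by right multiplication with the reflection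
  \<open>t\<close> conjugated past \<open>c\<close>, and the additive lengths still differ by
  one.\<close>

lemma covered_middle_factor:
  assumes c: "a \<in> carrier W" "c \<in> carrier W"
    and len: "len (a \<otimes> b \<otimes> c) = len a + len b + len c" "len (a \<otimes> b' \<otimes> c) = len a + len b' + len c"
    and cov: "b \<lhd>\<^sub>B b'"
  shows "a \<otimes> b \<otimes> c \<lhd>\<^sub>B a \<otimes> b' \<otimes> c"
proof -
  obtain t where t: "t \<in> reflections" "b' = b \<otimes> t" using covered_reflection[OF cov] .
  have b: "b \<in> carrier W" "len b' = Suc (len b)"
    using cov bruhat_le_carrier by (auto simp: covered_iff)
  let ?t = "inv c \<otimes> t \<otimes> inv (inv c)"
  have "?t \<in> reflections" using reflection_conj[OF t(1)] c by blast
  moreover have "a \<otimes> b' \<otimes> c = (a \<otimes> b \<otimes> c) \<otimes> ?t"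
    using t reflections_closed c b by (simp add: m_assoc)
  ultimately show ?thesis
    using bruhat_le_step[of "a \<otimes> b \<otimes> c" ?t] len b c by (simp add: covered_iff)
qed

lemma system_factorization_matched:
  assumes sys: "system_for w J H M" and w: "w \<in> carrier W"
    and fac: "system_factorization w J H M u a b c" and b: "b \<in> lower (max_par H w)"
    and len: "len (a \<otimes> M b \<otimes> c) = len a + len (M b) + len c"
  shows "u \<lhd>\<^sub>B a \<otimes> M b \<otimes> c \<longleftrightarrow> b \<lhd>\<^sub>B M b"
    "system_factorization w J H M (a \<otimes> M b \<otimes> c) a (M b) c"
proof -
  note basics = system_basics[OF sys w]
  have M: "M b \<in> lower (max_par H w)" "b \<lhd>\<^sub>B M b \<or> M b \<lhd>\<^sub>B b"
    using basics(7) b by (auto simp: matching_def covered_in_lower_iff)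
  then have "M b \<in> parabolic H"
    using basics(6) Supp_mono by (auto simp: lower_def parabolic_iff[OF basics(1)])
  then show "system_factorization w J H M (a \<otimes> M b \<otimes> c) a (M b) c"
    using fac len by (auto simp: system_factorization_def)
  have c: "a \<in> carrier W" "c \<in> carrier W" and u: "u = a \<otimes> b \<otimes> c" "len (a \<otimes> b \<otimes> c) = len a + len b + len c"
    using fac by (auto simp: system_factorization_def quot_R_def quot_L_def)
  show "u \<lhd>\<^sub>B a \<otimes> M b \<otimes> c \<longleftrightarrow> b \<lhd>\<^sub>B M b"
  proof
    assume "u \<lhd>\<^sub>B a \<otimes> M b \<otimes> c"
    then have "len (a \<otimes> M b \<otimes> c) = Suc (len (a \<otimes> b \<otimes> c))" unfolding u(1) covered_iff by blast
    then have "len (M b) = Suc (len b)" using len u(2) by simp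
    \<comment> \<open>Length decides the direction of the matched pair, since one of the two covers
      is known to hold.\<close>
    then have "\<not> M b \<lhd>\<^sub>B b" by (simp add: covered_iff)
    then show "b \<lhd>\<^sub>B M b" using M(2) by blast
  next
    assume "b \<lhd>\<^sub>B M b"
    then show "u \<lhd>\<^sub>B a \<otimes> M b \<otimes> c" unfolding u(1) by (rule covered_middle_factor[OF c u(2) len])
  qed
qed

lemma middle_factor_lower:
  assumes H: "H \<subseteq> S" and w: "w \<in> carrier W"
    and u: "u \<in> lower w \<or> u \<in> carrier W \<and> max_par H u \<preceq> max_par H w"
    and fac: "system_factorization w J H M u a b c"
  shows "b \<in> lower (max_par H w)"
proof -
  have c: "a \<in> carrier W" "b \<in> carrier W" "c \<in> carrier W" "b \<in> parabolic H"
    "u = a \<otimes> b \<otimes> c" "len (a \<otimes> b \<otimes> c) = len a + len b + len c"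
    using fac parabolic_closed[OF H] by (auto simp: system_factorization_def quot_R_def quot_L_def)
  then show ?thesis
    using dom_max_par[OF H w u c(4)] middle_factor_le by (auto simp: lower_def)
qed

lemma sys_map1_factorization:
  assumes sys: "system_for w J H M" and w: "w \<in> carrier W" and kind: "first_kind J H M"
    and u: "u \<in> lower w \<union> dom1 w J H" and fac: "system_factorization w J H M u a b c"
  shows "sys_map1 J H M u = a \<otimes> M b \<otimes> c"
    "u \<lhd>\<^sub>B sys_map1 J H M u \<longleftrightarrow> b \<lhd>\<^sub>B M b"
    "system_factorization w J H M (sys_map1 J H M u) a (M b) c"
proof -
  interpret first_kind_matching W S J "compl_of J M" H "M \<one>" "max_par H w" M
    by (rule first_kind_matching_of_system[OF sys w kind])
  have u': "u \<in> lower w \<or> u \<in> carrier W \<and> max_par H u \<preceq> max_par H w"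
    using u by (auto simp: dom1_def)
  have b: "b \<in> lower (max_par H w)" using middle_factor_lower[OF H_sub w u' fac] .
  have ad: "adapted a b c" and eq: "u = a \<otimes> b \<otimes> c"
    using fac b by (auto simp: adapted_def system_factorization_def left_admissible_def commutes_left_def)
  have "sys_map1 J H M u = a \<otimes> M b \<otimes> c" "len (a \<otimes> M b \<otimes> c) = len a + len (M b) + len c"
    using adapted_sys_map1[OF ad] dom_max_par[OF H_sub w u'] eq by auto
  then show "sys_map1 J H M u = a \<otimes> M b \<otimes> c"
    "u \<lhd>\<^sub>B sys_map1 J H M u \<longleftrightarrow> b \<lhd>\<^sub>B M b"
    "system_factorization w J H M (sys_map1 J H M u) a (M b) c"
    using system_factorization_matched[OF sys w fac b] by auto
qed

lemma sys_map2_factorization: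
  assumes sys: "system_for w J H M" and w: "w \<in> carrier W" and kind: "second_kind J H"
    and u: "u \<in> lower w \<union> dom2 w J H M" and fac: "system_factorization w J H M u a b c"
  shows "sys_map2 J H M u = a \<otimes> M b \<otimes> c"
    "u \<lhd>\<^sub>B sys_map2 J H M u \<longleftrightarrow> b \<lhd>\<^sub>B M b"
    "system_factorization w J H M (sys_map2 J H M u) a (M b) c"
proof -
  interpret op: first_kind_matching "opp W" S "compl_of J M" J H "M \<one>" "max_par H w" M
    by (rule opposite_matching_of_system[OF sys w kind])
  note basics = system_basics[OF sys w]
  note H = basics(1) and K = basics(3)
  let ?K = "compl_of J M"
  have u': "u \<in> lower w \<or> u \<in> carrier W \<and> max_par H u \<preceq> max_par H w"
    using u by (auto simp: dom2_def)
  have b: "b \<in> lower (max_par H w)" using middle_factor_lower[OF H w u' fac] .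
  have M: "M x \<in> carrier W" if "x \<in> lower (max_par H w)" for x
    using basics(7) that by (auto simp: matching_def lower_def)
  have c: "a \<in> carrier W" "b \<in> carrier W" "c \<in> carrier W" and eq: "u = a \<otimes> b \<otimes> c"
    using fac b by (auto simp: system_factorization_def quot_R_def quot_L_def lower_def)
  have ad: "op.adapted c b a"
    using fac b c
    by (auto simp: op.adapted_def system_factorization_def right_admissible_def commutes_right_def m_assoc)
  have "op.sys_map1 ?K H M u = a \<otimes> (M b \<otimes> c)" "len (a \<otimes> (M b \<otimes> c)) = len c + len (M b) + len a"
    using op.adapted_sys_map1[OF ad] dom_max_par[OF H w u'] eq c by (auto simp: m_assoc)
  \<comment> \<open>The two expressions differ by bracketing. Reassociating requires the value of
    \<open>M\<close> at the canonical middle factor to lie in the group, which is known only inside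
    \<open>lower (max_par H w)\<close>; the rest of this block places the middle factor
    there.\<close>
  moreover have "op.sys_map1 ?K H M u = sys_map2 J H M u"
  proof -
    have uc: "u \<in> carrier W" using eq c by simp
    let ?x = "par_L ?K u" and ?y = "min_L ?K u"
    have xy: "?y \<in> quot_L ?K" "?x \<in> parabolic ?K" "u = ?x \<otimes> ?y" using coset_parts[OF K uc] by auto
    then have xyc: "?x \<in> carrier W" "?y \<in> carrier W"
      using parabolic_closed[OF K] by (auto simp: quot_L_def)
    let ?x1 = "min_R H ?x" and ?x2 = "par_R H ?x" and ?y1 = "par_L H ?y" and ?y2 = "min_L H ?y"
    have x: "?x1 \<in> quot_R H" "?x2 \<in> parabolic H" "?x = ?x1 \<otimes> ?x2"
      and y: "?y2 \<in> quot_L H" "?y1 \<in> parabolic H" "?y = ?y1 \<otimes> ?y2"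
      using coset_parts[OF H xyc(1)] coset_parts[OF H xyc(2)] by auto
    then have c': "?x1 \<in> carrier W" "?x2 \<in> carrier W" "?y1 \<in> carrier W" "?y2 \<in> carrier W"
      using parabolic_closed[OF H] by (auto simp: quot_L_def quot_R_def)
    have ueq: "u = ?x1 \<otimes> (?x2 \<otimes> ?y1) \<otimes> ?y2"
    proof -
      have "u = (?x1 \<otimes> ?x2) \<otimes> (?y1 \<otimes> ?y2)" using xy x y by simp
      then show ?thesis using c' by (simp add: m_assoc)
    qed
    have "len u = len ?x + len ?y" "len ?x = len ?x1 + len ?x2" "len ?y = len ?y1 + len ?y2"
      using len_quot_L_mult[OF K xy(1,2)] xy(3) len_quot_R_mult[OF H x(1,2)] x(3)
        len_quot_L_mult[OF H y(1,2)] y(3) by simp_all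
    moreover have "len (?x2 \<otimes> ?y1) \<le> len ?x2 + len ?y1" using len_mult_le c' by blast
    moreover have "len u \<le> len ?x1 + len (?x2 \<otimes> ?y1) + len ?y2"
      using len_mult_le[of "?x1 \<otimes> (?x2 \<otimes> ?y1)" ?y2] len_mult_le[of ?x1 "?x2 \<otimes> ?y1"] ueq c' by simp
    \<comment> \<open>The lengths of the four pieces add up to \<open>len u\<close>, so joining the
      two middle pieces loses nothing.\<close>
    ultimately have "len u = len ?x1 + len (?x2 \<otimes> ?y1) + len ?y2" by linarith
    then have "?x2 \<otimes> ?y1 \<preceq> u"
      using middle_factor_le[of ?x1 "?x2 \<otimes> ?y1" ?y2] ueq c' by simp
    moreover have "?x2 \<otimes> ?y1 \<in> parabolic H" using x y parabolic_mult by blast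
    ultimately have "?x2 \<otimes> ?y1 \<in> lower (max_par H w)"
      using dom_max_par[OF H w u'] c' by (auto simp: lower_def)
    then have "M (?x2 \<otimes> ?y1) \<in> carrier W" using M by blast
    then show ?thesis
      using c' by (simp add: op.sys_map1_def sys_map2_def m_assoc)
  qed
  ultimately have map: "sys_map2 J H M u = a \<otimes> M b \<otimes> c"
    and len: "len (a \<otimes> M b \<otimes> c) = len a + len (M b) + len c"
    using M[OF b] c by (simp_all add: m_assoc)
  show "sys_map2 J H M u = a \<otimes> M b \<otimes> c"
    "u \<lhd>\<^sub>B sys_map2 J H M u \<longleftrightarrow> b \<lhd>\<^sub>B M b"
    "system_factorization w J H M (sys_map2 J H M u) a (M b) c"
    unfolding map using system_factorization_matched[OF sys w fac b len] by auto
qed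

text \<open>When both kinds apply, \<open>H = {s}\<close> and \<open>M\<close> merely exchanges
  \<open>\<one>\<close> and \<open>s\<close>, so the admissibility conditions hold automatically. A
  single factorization of \<open>u\<close> then evaluates both maps to the same product.\<close>

lemma sys_map1_eq_sys_map2:
  assumes sys: "system_for w J H M" and w: "w \<in> carrier W"
    and kind1: "first_kind J H M" and kind2: "second_kind J H" and u: "u \<in> lower w"
  shows "sys_map1 J H M u = sys_map2 J H M u"
proof -
  interpret first_kind_matching W S J "compl_of J M" H "M \<one>" "max_par H w" M
    by (rule first_kind_matching_of_system[OF sys w kind1])
  let ?s = "M \<one>" and ?v = "max_par H w"
  have Hs: "H = {?s}"
    using kind2 H_sub_K J_Int_K H_Int_comm by (auto simp: second_kind_def)
  have "Supp ?v \<subseteq> {?s}" using v_par Hs parabolic_iff[OF H_sub] by blast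
  moreover have "?v \<noteq> \<one>" using s_lower s_mem(1) bruhat_le_len[of ?s ?v] by (auto simp: lower_def)
  ultimately have "?v = ?s" using parabolic_singleton[OF s_mem(1) v_closed] by blast
  have low: "x = \<one> \<or> x = ?s" if "x \<in> lower ?v" for x
  proof -
    have "Supp x \<subseteq> {?s}" using lower_v(2)[OF that] Hs parabolic_iff[OF H_sub] by blast
    then show ?thesis using parabolic_singleton[OF s_mem(1) lower_v(1)[OF that]] by blast
  qed
  have comm: "commutes_left ?v M ?s" "commutes_right ?v M ?s"
  proof -
    have "M (?s \<otimes> x) = ?s \<otimes> M x" "M (x \<otimes> ?s) = M x \<otimes> ?s" if "x \<in> lower ?v" for x
      using low[OF that] s_mem M_s by auto
    moreover have "?s \<in> D_L ?v" "?s \<in> D_R ?v"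
      using s_mem unfolding \<open>?v = ?s\<close> by (auto simp: D_L_def D_R_def)
    ultimately show "commutes_left ?v M ?s" "commutes_right ?v M ?s"
      unfolding commutes_left_def commutes_right_def by blast+
  qed
  have card: "card (X \<inter> H) \<le> 1" for X
    unfolding Hs by (metis card_mono finite.emptyI finite_insert inf_le2 is_singletonI is_singleton_altdef)
  have le: "u \<preceq> w" and uc: "u \<in> carrier W" using u by (auto simp: lower_def)
  let ?a = "min_R J u" and ?y = "par_R J u"
  have a: "?a \<in> quot_R J" "?y \<in> parabolic J" "u = ?a \<otimes> ?y" using coset_parts[OF J_sub uc] by auto
  have yc: "?y \<in> carrier W" "?a \<in> carrier W" using a parabolic_closed[OF J_sub] by (auto simp: quot_R_def)
  let ?b = "par_L H ?y" and ?c = "min_L H ?y"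
  have b: "?c \<in> quot_L H" "?b \<in> parabolic H" "?y = ?b \<otimes> ?c" using coset_parts[OF H_sub yc(1)] by auto
  have bc: "?b \<in> carrier W" "?c \<in> carrier W"
    using b parabolic_closed[OF H_sub] by (auto simp: quot_L_def)
  \<comment> \<open>Since \<open>s\<close> belongs to \<open>J\<close>, the representative
    \<open>?a\<close> is already minimal for \<open>H\<close>; the whole middle factor is taken from
    \<open>u_J\<close>.\<close>
  have aH: "?a \<in> quot_R H" using a(1) s_mem Hs by (auto simp: quot_R_def)
  have aK: "?a \<in> parabolic (compl_of J M)"
    using min_R_mono_parabolic[OF J_sub K_sub le] sys by (simp add: system_for_def)
  have len_y: "len ?y = len ?b + len ?c" using len_quot_L_mult[OF H_sub b(1,2)] b(3) by simp
  then have "?c \<preceq> ?y" using le_mult_if_len_add(2)[of ?b ?c] bc b(3) by simp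
  then have cJ: "?c \<in> parabolic J" using Supp_mono a(2) bc by (fastforce simp: parabolic_iff[OF J_sub])
  have "u = ?a \<otimes> ?b \<otimes> ?c"
  proof -
    have "u = ?a \<otimes> (?b \<otimes> ?c)" using a(3) b(3) by simp
    then show ?thesis using yc bc by (simp add: m_assoc)
  qed
  moreover have "len u = len ?a + len ?b + len ?c"
    using len_quot_R_mult[OF J_sub a(1,2)] a(3) len_y by simp
  ultimately have fac: "system_factorization w J H M u ?a ?b ?c"
    using aK aH b cJ card comm Hs
    by (auto simp: system_factorization_def left_admissible_def right_admissible_def)
  show ?thesis
    using sys_map1_factorization(1)[OF sys w kind1 _ fac] sys_map2_factorization(1)[OF sys w kind2 _ fac] u
    by simp
qed

end

theorem theorem4p10:
  fixes W :: "('a, 'b) monoid_scheme" (structure)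
    and S J H :: "'a set" and w :: 'a and M :: "'a \<Rightarrow> 'a"
  assumes "coxeter_system W S"
    and "w \<in> carrier W"
    and "coxeter_system.system_for W S w J H M"
  shows
    "(coxeter_system.first_kind W S J H M \<longrightarrow>
       (\<forall>u \<in> coxeter_system.lower W S w \<union> coxeter_system.dom1 W S w J H. \<forall>a b c.
          coxeter_system.system_factorization W S w J H M u a b c \<longrightarrow>
            coxeter_system.sys_map1 W S J H M u = a \<otimes> M b \<otimes> c \<and>
            (coxeter_system.covered W S u (coxeter_system.sys_map1 W S J H M u)
               \<longleftrightarrow> coxeter_system.covered W S b (M b)) \<and>
            coxeter_system.system_factorization W S w J H M
              (coxeter_system.sys_map1 W S J H M u) a (M b) c)) \<and>
     (coxeter_system.second_kind J H \<longrightarrow>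
       (\<forall>u \<in> coxeter_system.lower W S w \<union> coxeter_system.dom2 W S w J H M. \<forall>a b c.
          coxeter_system.system_factorization W S w J H M u a b c \<longrightarrow>
            coxeter_system.sys_map2 W S J H M u = a \<otimes> M b \<otimes> c \<and>
            (coxeter_system.covered W S u (coxeter_system.sys_map2 W S J H M u)
               \<longleftrightarrow> coxeter_system.covered W S b (M b)) \<and>
            coxeter_system.system_factorization W S w J H M
              (coxeter_system.sys_map2 W S J H M u) a (M b) c)) \<and>
     (coxeter_system.first_kind W S J H M \<and> coxeter_system.second_kind J H \<longrightarrow>
       (\<forall>u \<in> coxeter_system.lower W S w.
          coxeter_system.sys_map1 W S J H M u = coxeter_system.sys_map2 W S J H M u))"
proof -
  interpret coxeter_system W S by fact
  note sys = assms(3,2)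
  show ?thesis
  proof (intro conjI impI ballI allI)
    fix u a b c
    assume *: "first_kind J H M" "u \<in> lower w \<union> dom1 w J H" "system_factorization w J H M u a b c"
    note sys_map1_factorization[OF sys *]
    then show "sys_map1 J H M u = a \<otimes> M b \<otimes> c"
      "u \<lhd>\<^sub>B sys_map1 J H M u \<longleftrightarrow> b \<lhd>\<^sub>B M b"
      "system_factorization w J H M (sys_map1 J H M u) a (M b) c" by auto
  next
    fix u a b c
    assume *: "second_kind J H" "u \<in> lower w \<union> dom2 w J H M" "system_factorization w J H M u a b c"
    note sys_map2_factorization[OF sys *]
    then show "sys_map2 J H M u = a \<otimes> M b \<otimes> c"
      "u \<lhd>\<^sub>B sys_map2 J H M u \<longleftrightarrow> b \<lhd>\<^sub>B M b"
      "system_factorization w J H M (sys_map2 J H M u) a (M b) c" by auto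
  next
    fix u
    assume "first_kind J H M \<and> second_kind J H" "u \<in> lower w"
    then show "sys_map1 J H M u = sys_map2 J H M u"
      using sys_map1_eq_sys_map2[OF sys] by blast
  qed
qed

end
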